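(* Assume: (A1) For all $\tilde z,\tilde\theta\in\mathcal A$, the functional $\tilde a\mapsto U(\tilde a,\tilde z,\tilde\theta)$ is continuously Gâteaux differentiable and strongly concave with constant $\alpha_U>0$, i.e. $U(\tilde a,\tilde z,\tilde\theta)+\frac{\alpha_U}{2}\|\tilde a\|_{\mathcal A}^2$ is concave in $\tilde a$; moreover $\nabla_{\tilde a}U(\cdot,\tilde z,\tilde\theta)$ is Lipschitz continuous in $\tilde z,\tilde\theta$ with constants $\ell_U,\ell_\theta$, i.e. $\|\nabla_{\tilde a}U(\tilde a,\tilde z_1,\tilde\theta_1)-\nabla_{\tilde a}U(\tilde a,\tilde z_2,\tilde\theta_2)\|_{\mathcal A}\le \ell_U\|\tilde z_1-\tilde z_2\|_{\mathcal A}+\ell_\theta\|\tilde\theta_1-\tilde\theta_2\|_{\mathcal A}$ for all $\tilde a,\tilde z_i,\tilde\theta_i\in\mathcal A$. (A2) For each $x\in[0,1]$ the set $\mathcal A^x\subset\mathcal A$ is nonempty, convex and closed, and there exist $\tilde z_0,\tilde\theta_0\in\mathcal A$ such that $\big(\arg\max_{\tilde a\in\mathcal A^x}U(\tilde a,\tilde z_0,\tilde\theta_0)\big)_{x\in[0,1]}\in\mathcal A^\infty$. Then: (i) Fix a graphon $W\in\mathcal W_0$. If $\ell_U\cdot\lambda_1(\boldsymbol W)<\alpha_U$, the graphon game $\mathcal G(\mathcal A_{ad}^\infty,U,\theta,W)$ admits a unique Nash equilibrium. (ii) Consequently, if $\ell_U<\alpha_U$, the graphon game $\mathcal G(\mathcal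 A_{ad}^\infty,U,\theta,W)$ admits a unique Nash equilibrium for every graphon $W\in\mathcal W_0$.
   Context: Probabilistic setting. Fix $T>0$, a probability space $(\Omega,\mathcal F,\mathbb P)$, a probability space $([0,1],\mathcal I,\nu)$ extending the Lebesgue space on $[0,1]$, and a rich Fubini extension $([0,1]\times\Omega,\mathcal I\boxtimes\mathcal F,\nu\boxtimes\mathbb P)$ of the product space (an extension on which Fubini's theorem $\int f\,d(\nu\boxtimes\mathbb P)=\int_0^1\mathbb E[f(x)]\nu(dx)=\mathbb E[\int_0^1 f(x)\nu(dx)]$ holds for all integrable $f$, and which supports essentially pairwise independent families of processes). Write $dx$ for $\nu(dx)$. $\mathbb F=(\mathcal F_t)_{0\le t\le T}$ is the augmentation of the filtration generated by the heterogeneity processes $(\theta^x)_{x\in[0,1]}$. $\mathcal A$ is the Hilbert space of $\mathbb F$-progressively measurable $\tilde a:\Omega\times[0,T]\to\mathbb R$ with $\|\tilde a\|_{\mathcal A}^2=\int_0^T\mathbb E[\tilde a_t^2]dt<\infty$, with inner product $\langle\tilde a,\tilde b\rangle_{\mathcal A}=\mathbb E[\int_0^T\tilde a_t\tilde b_tdt]$. An action profile is a family $a=(a^x)_{x\in[0,1]}$, $a^x\in\mathcal A$, with $(x,t,\omega)\mapsto a^x_t(\omega)$ being $\mathcal I\otimes\mathcal B([0,T])\otimes\mathcal F$-measurable; $\mathcal A^\infty$ is the Hilbert space of action profiles with $\|a\|_{\mathcal A^\infty}^2=\int_0^1\int_0^T\mathbb E[(a_t^x)^2]dtdx<\infty$.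 Graphon game. $U:\mathcal A\times\mathcal A\times\mathcal A\to\mathbb R$ is a given utility functional, $\theta=(\theta^x)_{x\in[0,1]}\in\mathcal A^\infty$ a heterogeneity profile. $\mathcal W_0$ is the set of graphons, i.e. symmetric measurable $W:[0,1]^2\to[0,1]$; $(\boldsymbol Wf)(x)=\int_0^1W(x,y)f(y)dy$ is the induced operator on $L^2([0,1],\mathbb R)$ (also applied to elements of $\mathcal A^\infty$), and $\lambda_1(\boldsymbol W)$ is its largest eigenvalue. Each player $x$ has a set of admissible actions $\mathcal A^x\subset\mathcal A$, and $\mathcal A_{ad}^\infty=\{a\in\mathcal A^\infty: a^x\in\mathcal A^x\ \forall x\in[0,1]\}$. The local aggregate is $z^x(a)=(\boldsymbol Wa)(x)=\int_0^1W(x,y)a^ydy$. A Nash equilibrium of $\mathcal G(\mathcal A_{ad}^\infty,U,\theta,W)$ is a profile $\bar a\in\mathcal A_{ad}^\infty$ such that for every $x\in[0,1]$, $\bar a^x=\arg\max_{\tilde a\in\mathcal A^x}U(\tilde a,z^x(\bar a),\theta^x)$.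
   Formalization: The formal theorem adds that for every z in A^∞ the maximisers of U(·, z^x, θ^x) over A^x can be chosen jointly measurably in (x,t,ω); without this, existence fails for non-measurable families (A^x). *)

theory Defs
  imports "HOL-Probability.Probability"
begin

section \<open>The index space and the probabilistic setting\<close>

definition extends_lebesgue :: "real measure \<Rightarrow> bool" where
  "extends_lebesgue N \<longleftrightarrow>
     prob_space N \<and> space N = {0..1} \<and>
     (\<forall>A \<in> sets (lebesgue_on {0..1}).
        A \<in> sets N \<and> emeasure N A = emeasure (lebesgue_on {0..1}) A)"

definition fubini_extension ::
    "real measure \<Rightarrow> 'w measure \<Rightarrow> (real \<times> 'w) measure \<Rightarrow> bool" where
  "fubini_extension N P E \<longleftrightarrow>
     prob_space E \<and> space E = space N \<times> space P \<and>
     (\<forall>A \<in> sets (N \<Otimes>\<^sub>M P).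
        A \<in> sets E \<and> emeasure E A = emeasure (N \<Otimes>\<^sub>M P) A) \<and>
     (\<forall>f :: real \<times> 'w \<Rightarrow> real. integrable E f \<longrightarrow>
        (AE x in N. integrable P (\<lambda>w. f (x, w))) \<and>
        (AE w in P. integrable N (\<lambda>x. f (x, w))) \<and>
        integrable N (\<lambda>x. \<integral>w. f (x, w) \<partial>P) \<and>
        integrable P (\<lambda>w. \<integral>x. f (x, w) \<partial>N) \<and>
        (\<integral>xw. f xw \<partial>E) = (\<integral>x. (\<integral>w. f (x, w) \<partial>P) \<partial>N) \<and>
        (\<integral>xw. f xw \<partial>E) = (\<integral>w. (\<integral>x. f (x, w) \<partial>N) \<partial>P))"

text \<open>
  Richness in the sense of Sun: the extension carries an essentially pairwise independent
  process whose marginals are uniform on the unit interval.  All other essentially pairwise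
  independent families are obtained from it by quantile transforms.
\<close>

definition rich_fubini_extension ::
    "real measure \<Rightarrow> 'w measure \<Rightarrow> (real \<times> 'w) measure \<Rightarrow> bool" where
  "rich_fubini_extension N P E \<longleftrightarrow>
     fubini_extension N P E \<and>
     (\<exists>f \<in> borel_measurable E.
        (AE x in N. distr P borel (\<lambda>w. f (x, w)) = uniform_measure lborel {0..1::real}) \<and>
        (AE x in N. AE y in N.
           prob_space.indep_var P borel (\<lambda>w. f (x, w)) borel (\<lambda>w. f (y, w))))"


section \<open>Processes and action profiles\<close>

text \<open>
  Processes are written as functions of time and scenario, profiles as functions of player,
  time and scenario.  Only their values for players in \<open>[0,1]\<close>, times in \<open>[0,T]\<close> and scenarios
  in \<open>space P\<close> matter.
\<close>

type_synonym 'w process = "real \<Rightarrow> 'w \<Rightarrow> real"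
type_synonym 'w profile = "real \<Rightarrow> 'w process"

definition time_measure :: "real \<Rightarrow> real measure" where
  "time_measure T = restrict_space lborel {0..T}"

text \<open>
  The augmentation adjoins the \<open>P\<close>-null sets to each member of the natural filtration of
  the whole family \<open>\<theta>\<close>.
\<close>

definition aug_filtration :: "'w measure \<Rightarrow> 'w profile \<Rightarrow> real \<Rightarrow> 'w measure" where
  "aug_filtration P \<theta> t =
     sigma (space P)
       ({\<theta> x s -` B \<inter> space P | x s B. x \<in> {0..1} \<and> s \<in> {0..t} \<and> B \<in> sets borel}
        \<union> null_sets P)"

definition progressive :: "real \<Rightarrow> (real \<Rightarrow> 'w measure) \<Rightarrow> 'w process \<Rightarrow> bool" where
  "progressive T F a \<longleftrightarrow>
     (\<forall>t \<in> {0..T}. (\<lambda>(s, w). a s w) \<in> borel_measurable (restrict_space borel {0..t} \<Otimes>\<^sub>M F t))"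

text \<open>Equality of processes as elements of \<open>L\<^sup>2([0,T] \<times> \<Omega>)\<close>.\<close>

definition same_process :: "'w measure \<Rightarrow> real \<Rightarrow> 'w process \<Rightarrow> 'w process \<Rightarrow> bool" where
  "same_process P T a b \<longleftrightarrow> (AE (t, w) in time_measure T \<Otimes>\<^sub>M P. a t w = b t w)"

text \<open>
  Elements of the Hilbert space of square-integrable progressively measurable processes are
  classes of processes that agree \<open>dt \<otimes> P\<close>-almost everywhere.  The following set contains
  every measurable representative of such a class: a process belongs to it iff it
  agrees almost everywhere with a progressively measurable one.  This makes the set closed under
  changes on null sets, in particular under pointwise integration over the players, which
  produces a specific representative of the class of the local aggregate.
\<close>

definition actions ::
    "'w measure \<Rightarrow> real \<Rightarrow> (real \<Rightarrow> 'w measure) \<Rightarrow> 'w process set" where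
  "actions P T F =
     {a. (\<lambda>(t, w). a t w) \<in> borel_measurable (time_measure T \<Otimes>\<^sub>M P) \<and>
         (\<exists>p. progressive T F p \<and> same_process P T a p) \<and>
         (\<integral>\<^sup>+t. (\<integral>\<^sup>+w. ennreal ((a t w)\<^sup>2) \<partial>P) \<partial>time_measure T) < \<infinity>}"

definition act_inner :: "'w measure \<Rightarrow> real \<Rightarrow> 'w process \<Rightarrow> 'w process \<Rightarrow> real" where
  "act_inner P T a b = (\<integral>w. (\<integral>t. a t w * b t w \<partial>time_measure T) \<partial>P)"

definition act_norm :: "'w measure \<Rightarrow> real \<Rightarrow> 'w process \<Rightarrow> real" where
  "act_norm P T a = sqrt (\<integral>t. (\<integral>w. (a t w)\<^sup>2 \<partial>P) \<partial>time_measure T)"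

definition act_dist :: "'w measure \<Rightarrow> real \<Rightarrow> 'w process \<Rightarrow> 'w process \<Rightarrow> real" where
  "act_dist P T a b = act_norm P T (\<lambda>t w. a t w - b t w)"

definition measurable_profile ::
    "real measure \<Rightarrow> 'w measure \<Rightarrow> real \<Rightarrow> 'w profile \<Rightarrow> bool" where
  "measurable_profile N P T a \<longleftrightarrow>
     (\<lambda>(x, t, w). a x t w) \<in> borel_measurable (N \<Otimes>\<^sub>M (time_measure T \<Otimes>\<^sub>M P))"

definition action_profiles ::
    "real measure \<Rightarrow> 'w measure \<Rightarrow> real \<Rightarrow> (real \<Rightarrow> 'w measure) \<Rightarrow> 'w profile set" where
  "action_profiles N P T F =
     {a. measurable_profile N P T a \<and> (\<forall>x \<in> {0..1}. a x \<in> actions P T F) \<and>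
         (\<integral>\<^sup>+x. (\<integral>\<^sup>+t. (\<integral>\<^sup>+w. ennreal ((a x t w)\<^sup>2) \<partial>P) \<partial>time_measure T) \<partial>N) < \<infinity>}"


section \<open>Graphons\<close>

text \<open>
  Measurability with respect to the product of the Lebesgue sigma-algebras (rather than its
  completion) guarantees that every section \<open>W x\<close> is measurable, so that the local aggregate is
  defined for every player.
\<close>

definition graphon :: "(real \<Rightarrow> real \<Rightarrow> real) \<Rightarrow> bool" where
  "graphon W \<longleftrightarrow>
     (\<lambda>(x, y). W x y) \<in> borel_measurable (lebesgue_on {0..1} \<Otimes>\<^sub>M lebesgue_on {0..1}) \<and>
     (\<forall>x \<in> {0..1}. \<forall>y \<in> {0..1}. 0 \<le> W x y \<and> W x y \<le> 1 \<and> W x y = W y x)"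

definition graphon_op ::
    "real measure \<Rightarrow> (real \<Rightarrow> real \<Rightarrow> real) \<Rightarrow> (real \<Rightarrow> real) \<Rightarrow> real \<Rightarrow> real" where
  "graphon_op N W f x = (\<integral>y. W x y * f y \<partial>N)"

definition graphon_eigenvalue ::
    "real measure \<Rightarrow> (real \<Rightarrow> real \<Rightarrow> real) \<Rightarrow> real \<Rightarrow> bool" where
  "graphon_eigenvalue N W l \<longleftrightarrow>
     (\<exists>f \<in> borel_measurable N. integrable N (\<lambda>x. (f x)\<^sup>2) \<and> \<not> (AE x in N. f x = 0) \<and>
        (AE x in N. graphon_op N W f x = l * f x))"

definition lambda_1 :: "real measure \<Rightarrow> (real \<Rightarrow> real \<Rightarrow> real) \<Rightarrow> real" where
  "lambda_1 N W = (GREATEST l. graphon_eigenvalue N W l)"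

definition local_aggregate ::
    "real measure \<Rightarrow> (real \<Rightarrow> real \<Rightarrow> real) \<Rightarrow> 'w profile \<Rightarrow> 'w profile" where
  "local_aggregate N W a x = (\<lambda>t w. graphon_op N W (\<lambda>y. a y t w) x)"


section \<open>The game\<close>

text \<open>Utility functionals take an own action, an aggregate and a heterogeneity process.\<close>

type_synonym 'w utility = "'w process \<Rightarrow> 'w process \<Rightarrow> 'w process \<Rightarrow> real"

text \<open>
  A functional on triples of classes: the value does not depend on the representatives.
\<close>

definition utility_functional ::
    "'w measure \<Rightarrow> real \<Rightarrow> (real \<Rightarrow> 'w measure) \<Rightarrow> 'w utility \<Rightarrow> bool" where
  "utility_functional P T F U \<longleftrightarrow>
     (\<forall>a \<in> actions P T F. \<forall>a' \<in> actions P T F. \<forall>z \<in> actions P T F. \<forall>z' \<in> actions P T F.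
      \<forall>h \<in> actions P T F. \<forall>h' \<in> actions P T F.
        same_process P T a a' \<and> same_process P T z z' \<and> same_process P T h h' \<longrightarrow>
        U a z h = U a' z' h')"

definition has_gateaux_gradient ::
    "'w measure \<Rightarrow> real \<Rightarrow> (real \<Rightarrow> 'w measure) \<Rightarrow>
     ('w process \<Rightarrow> real) \<Rightarrow> 'w process \<Rightarrow> 'w process \<Rightarrow> bool" where
  "has_gateaux_gradient P T F f g a \<longleftrightarrow>
     g \<in> actions P T F \<and>
     (\<forall>h \<in> actions P T F.
        ((\<lambda>\<epsilon>::real. (f (\<lambda>t w. a t w + \<epsilon> * h t w) - f a) / \<epsilon>)
          \<longlongrightarrow> act_inner P T g h) (at 0))"

definition continuous_on_actions ::
    "'w measure \<Rightarrow> real \<Rightarrow> (real \<Rightarrow> 'w measure) \<Rightarrow> ('w process \<Rightarrow> 'w process) \<Rightarrow> bool" where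
  "continuous_on_actions P T F G \<longleftrightarrow>
     (\<forall>a \<in> actions P T F. \<forall>\<epsilon>>0. \<exists>\<delta>>0. \<forall>b \<in> actions P T F.
        act_dist P T a b < \<delta> \<longrightarrow> act_dist P T (G a) (G b) < \<epsilon>)"

definition strongly_concave ::
    "'w measure \<Rightarrow> real \<Rightarrow> (real \<Rightarrow> 'w measure) \<Rightarrow> real \<Rightarrow> ('w process \<Rightarrow> real) \<Rightarrow> bool" where
  "strongly_concave P T F \<alpha> f \<longleftrightarrow>
     (let g = (\<lambda>a. f a + \<alpha> / 2 * (act_norm P T a)\<^sup>2)
      in \<forall>a \<in> actions P T F. \<forall>b \<in> actions P T F. \<forall>u \<in> {0..1}.
           (1 - u) * g a + u * g b \<le> g (\<lambda>t w. (1 - u) * a t w + u * b t w))"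

definition assumption_A1 ::
    "'w measure \<Rightarrow> real \<Rightarrow> (real \<Rightarrow> 'w measure) \<Rightarrow> 'w utility \<Rightarrow> real \<Rightarrow> real \<Rightarrow> real \<Rightarrow> bool" where
  "assumption_A1 P T F U \<alpha> l\<^sub>U l\<^sub>\<theta> \<longleftrightarrow>
     \<alpha> > 0 \<and>
     (\<exists>G :: 'w process \<Rightarrow> 'w process \<Rightarrow> 'w process \<Rightarrow> 'w process.
        (\<forall>z \<in> actions P T F. \<forall>h \<in> actions P T F.
           (\<forall>a \<in> actions P T F. has_gateaux_gradient P T F (\<lambda>a. U a z h) (G a z h) a) \<and>
           continuous_on_actions P T F (\<lambda>a. G a z h) \<and>
           strongly_concave P T F \<alpha> (\<lambda>a. U a z h)) \<and>
        (\<forall>a \<in> actions P T F. \<forall>z\<^sub>1 \<in> actions P T F. \<forall>z\<^sub>2 \<in> actions P T F.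
         \<forall>h\<^sub>1 \<in> actions P T F. \<forall>h\<^sub>2 \<in> actions P T F.
           act_dist P T (G a z\<^sub>1 h\<^sub>1) (G a z\<^sub>2 h\<^sub>2)
             \<le> l\<^sub>U * act_dist P T z\<^sub>1 z\<^sub>2 + l\<^sub>\<theta> * act_dist P T h\<^sub>1 h\<^sub>2))"

definition convex_actions :: "'w process set \<Rightarrow> bool" where
  "convex_actions C \<longleftrightarrow>
     (\<forall>a \<in> C. \<forall>b \<in> C. \<forall>u \<in> {0..1}. (\<lambda>t w. (1 - u) * a t w + u * b t w) \<in> C)"

text \<open>Closedness for the seminorm; such a set is automatically a union of classes.\<close>

definition closed_actions ::
    "'w measure \<Rightarrow> real \<Rightarrow> (real \<Rightarrow> 'w measure) \<Rightarrow> 'w process set \<Rightarrow> bool" where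
  "closed_actions P T F C \<longleftrightarrow>
     (\<forall>s a. (\<forall>n::nat. s n \<in> C) \<and> a \<in> actions P T F \<and>
        (\<lambda>n. act_dist P T (s n) a) \<longlonglongrightarrow> 0 \<longrightarrow> a \<in> C)"

text \<open>
  \<open>b\<close> represents the family of maximisers of \<open>U(\<cdot>, z x, h x)\<close> over \<open>A x\<close>.  Under strong concavity
  each maximiser is unique as a class.
\<close>

definition best_response ::
    "'w utility \<Rightarrow> (real \<Rightarrow> 'w process set) \<Rightarrow> 'w profile \<Rightarrow> 'w profile \<Rightarrow> 'w profile \<Rightarrow> bool" where
  "best_response U A z h b \<longleftrightarrow>
     (\<forall>x \<in> {0..1}. is_arg_max (\<lambda>a. U a (z x) (h x)) (\<lambda>a. a \<in> A x) (b x))"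

definition assumption_A2 ::
    "real measure \<Rightarrow> 'w measure \<Rightarrow> real \<Rightarrow> (real \<Rightarrow> 'w measure) \<Rightarrow> 'w utility \<Rightarrow>
     (real \<Rightarrow> 'w process set) \<Rightarrow> bool" where
  "assumption_A2 N P T F U A \<longleftrightarrow>
     (\<forall>x \<in> {0..1}. A x \<subseteq> actions P T F \<and> A x \<noteq> {} \<and>
        convex_actions (A x) \<and> closed_actions P T F (A x)) \<and>
     (\<exists>z\<^sub>0 \<in> actions P T F. \<exists>\<theta>\<^sub>0 \<in> actions P T F. \<exists>b \<in> action_profiles N P T F.
        best_response U A (\<lambda>x. z\<^sub>0) (\<lambda>x. \<theta>\<^sub>0) b)"

text \<open>
  Maximisers against a profile of aggregates can be chosen jointly measurably.  Since \<open>x \<mapsto> A x\<close> is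
  otherwise an arbitrary family of sets, this is not implied by the preceding two assumptions:
  for a non-measurable \<open>S\<close>, let \<open>A x\<close> be the constants in \<open>[0,1]\<close> if \<open>x \<in> S\<close> and \<open>{0}\<close> otherwise, and
  let \<open>U a z h = \<langle>a, h\<rangle> - \<parallel>a\<parallel>\<^sup>2 / 2\<close>.  Against \<open>h = 0\<close> the maximisers vanish, but against \<open>h = 1\<close> they form
  the indicator of \<open>S\<close>, and the game with \<open>\<theta> = 1\<close> has no equilibrium among measurable
  profiles.  Square integrability in \<open>x\<close> is not part of this condition.
\<close>

definition measurable_best_responses ::
    "real measure \<Rightarrow> 'w measure \<Rightarrow> real \<Rightarrow> (real \<Rightarrow> 'w measure) \<Rightarrow> 'w utility \<Rightarrow>
     (real \<Rightarrow> 'w process set) \<Rightarrow> 'w profile \<Rightarrow> bool" where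
  "measurable_best_responses N P T F U A \<theta> \<longleftrightarrow>
     (\<forall>z \<in> action_profiles N P T F. \<exists>b. measurable_profile N P T b \<and> best_response U A z \<theta> b)"

definition admissible_profiles ::
    "real measure \<Rightarrow> 'w measure \<Rightarrow> real \<Rightarrow> (real \<Rightarrow> 'w measure) \<Rightarrow>
     (real \<Rightarrow> 'w process set) \<Rightarrow> 'w profile set" where
  "admissible_profiles N P T F A =
     {a \<in> action_profiles N P T F. \<forall>x \<in> {0..1}. a x \<in> A x}"

definition nash_equilibrium ::
    "real measure \<Rightarrow> 'w measure \<Rightarrow> real \<Rightarrow> (real \<Rightarrow> 'w measure) \<Rightarrow> (real \<Rightarrow> 'w process set) \<Rightarrow>
     'w utility \<Rightarrow> 'w profile \<Rightarrow> (real \<Rightarrow> real \<Rightarrow> real) \<Rightarrow> 'w profile \<Rightarrow> bool" where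
  "nash_equilibrium N P T F A U \<theta> W a \<longleftrightarrow>
     a \<in> admissible_profiles N P T F A \<and> best_response U A (local_aggregate N W a) \<theta> a"

text \<open>Uniqueness: any two equilibria give every player the same element of the action space.\<close>

definition unique_nash_equilibrium ::
    "real measure \<Rightarrow> 'w measure \<Rightarrow> real \<Rightarrow> (real \<Rightarrow> 'w measure) \<Rightarrow> (real \<Rightarrow> 'w process set) \<Rightarrow>
     'w utility \<Rightarrow> 'w profile \<Rightarrow> (real \<Rightarrow> real \<Rightarrow> real) \<Rightarrow> bool" where
  "unique_nash_equilibrium N P T F A U \<theta> W \<longleftrightarrow>
     (\<exists>a. nash_equilibrium N P T F A U \<theta> W a) \<and>
     (\<forall>a b. nash_equilibrium N P T F A U \<theta> W a \<and> nash_equilibrium N P T F A U \<theta> W b \<longrightarrow>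
        (\<forall>x \<in> {0..1}. same_process P T (a x) (b x)))"

end

(*
  The operator norm c of the graphon operator W on L^2(N) equals lambda_1(W).  If c > 0, let A = W / c
  and iterate the kernels A^n W.  Their Hilbert-Schmidt norms decrease, and since A is symmetric
  <A^j W, A^k W> depends only on j + k, so the even iterates converge in L^2(N x N) to a nonnegative
  kernel Q with A^2 Q = Q.  The Hilbert-Schmidt norm of A^n W is at least c, so Q is nonzero, and
  for a suitable section f of Q the function A f + f is an eigenfunction for the eigenvalue c.

  Strong concavity and the mean value theorem along the segment between two maximisers show that
  best replies depend on the aggregate in a Lipschitz way with constant l_U / alpha.  Together with
  the norm bound for W this makes the best-reply map a contraction with constant
  l_U lambda_1(W) / alpha, and its Picard iterates converge to the unique equilibrium.
*)
theory Submission
  imports Defs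
begin

section \<open>Square-integrable functions\<close>

text \<open>Three obstacles shape the proof. First, \<open>lambda_1\<close> is a
  \<open>GREATEST\<close>, so the eigenvalue must be shown to be attained. If -c is also an
  eigenvalue, A^n W need not converge; the even iterates do, and they converge in norm, so a lower
  bound on their norms passes to the limit without any compactness argument. Second, an equilibrium
  concerns every player, while a contraction for the L2 distance of profiles controls almost every
  player only. As W is bounded by 1 everywhere, Cauchy-Schwarz bounds the change of each single
  aggregate by the L2 distance, and this carries convergence and uniqueness over to all players.
  Third, the aggregate must again be an action, although the progressive versions of the players'
  actions need not be jointly measurable in the player. Throughout, L2 spaces are sets of functions
  with a seminorm and not quotients, because actions and best replies are given by
  representatives.\<close>

definition L2 :: "'a measure \<Rightarrow> ('a \<Rightarrow> real) set" where
  "L2 M = {f \<in> borel_measurable M. integrable M (\<lambda>x. (f x)\<^sup>2)}"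

definition L2_inner :: "'a measure \<Rightarrow> ('a \<Rightarrow> real) \<Rightarrow> ('a \<Rightarrow> real) \<Rightarrow> real" where
  "L2_inner M f g = (\<integral>x. f x * g x \<partial>M)"

definition L2_norm :: "'a measure \<Rightarrow> ('a \<Rightarrow> real) \<Rightarrow> real" where
  "L2_norm M f = sqrt (\<integral>x. (f x)\<^sup>2 \<partial>M)"

lemma L2_measurable: "f \<in> L2 M \<Longrightarrow> f \<in> borel_measurable M"
  by (simp add: L2_def)

lemma L2_integrable_square: "f \<in> L2 M \<Longrightarrow> integrable M (\<lambda>x. (f x)\<^sup>2)"
  by (simp add: L2_def)

lemma L2_iff_nn_integral:
  "f \<in> L2 M \<longleftrightarrow> f \<in> borel_measurable M \<and> (\<integral>\<^sup>+x. ennreal ((f x)\<^sup>2) \<partial>M) < \<infinity>"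
  by (auto simp: L2_def integrable_iff_bounded)

lemma L2_dominated:
  assumes "f \<in> borel_measurable M" "integrable M g" "\<And>x. x \<in> space M \<Longrightarrow> (f x)\<^sup>2 \<le> g x"
  shows "f \<in> L2 M"
  unfolding L2_def using assms
  by (auto intro!: Bochner_Integration.integrable_bound[OF assms(2)] AE_I2 order.trans[OF _ abs_ge_self])

lemma L2_mult_integrable:
  assumes "f \<in> L2 M" "g \<in> L2 M"
  shows "integrable M (\<lambda>x. f x * g x)"
proof (rule Bochner_Integration.integrable_bound)
  show "integrable M (\<lambda>x. (f x)\<^sup>2 + (g x)\<^sup>2)"
    using assms by (simp add: L2_def)
  have "\<bar>a * b\<bar> \<le> a\<^sup>2 + b\<^sup>2" for a b :: real
  proof -
    have "2 * (\<bar>a\<bar> * \<bar>b\<bar>) \<le> a\<^sup>2 + b\<^sup>2"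
      using sum_squares_bound[of "\<bar>a\<bar>" "\<bar>b\<bar>"] by (simp add: mult.assoc)
    then show ?thesis
      using mult_nonneg_nonneg[of "\<bar>a\<bar>" "\<bar>b\<bar>"] unfolding abs_mult by linarith
  qed
  then show "AE x in M. norm (f x * g x) \<le> norm ((f x)\<^sup>2 + (g x)\<^sup>2)"
    by simp
qed (use assms in \<open>auto simp: L2_def\<close>)

lemma L2_scale: "f \<in> L2 M \<Longrightarrow> (\<lambda>x. c * f x) \<in> L2 M"
  by (auto simp: L2_def power_mult_distrib)

lemma L2_abs: "f \<in> L2 M \<Longrightarrow> (\<lambda>x. \<bar>f x\<bar>) \<in> L2 M"
  by (auto simp: L2_def)

lemma L2_add:
  assumes "f \<in> L2 M" "g \<in> L2 M"
  shows "(\<lambda>x. f x + g x) \<in> L2 M"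
  using assms L2_mult_integrable[OF assms] by (auto simp: L2_def power2_sum mult.assoc)

lemma L2_diff:
  assumes "f \<in> L2 M" "g \<in> L2 M"
  shows "(\<lambda>x. f x - g x) \<in> L2 M"
  using L2_add[OF assms(1) L2_scale[OF assms(2), of "-1"]] by simp

lemma L2_zero: "(\<lambda>x. 0) \<in> L2 M"
  by (simp add: L2_def)

lemma L2_norm_nonneg: "0 \<le> L2_norm M f"
  by (simp add: L2_norm_def)

lemma L2_norm_zero: "L2_norm M (\<lambda>x. 0) = 0"
  by (simp add: L2_norm_def)

lemma L2_norm_square: "(L2_norm M f)\<^sup>2 = (\<integral>x. (f x)\<^sup>2 \<partial>M)"
  by (simp add: L2_norm_def)

lemma L2_norm_square_inner: "(L2_norm M f)\<^sup>2 = L2_inner M f f"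
  by (simp add: L2_norm_def L2_inner_def power2_eq_square)

lemma L2_nn_integral:
  assumes "f \<in> L2 M"
  shows "(\<integral>\<^sup>+x. ennreal ((f x)\<^sup>2) \<partial>M) = ennreal ((L2_norm M f)\<^sup>2)"
  unfolding L2_norm_square by (rule nn_integral_eq_integral) (use assms in \<open>auto simp: L2_def\<close>)

lemma L2_norm_leI:
  assumes "f \<in> borel_measurable M" "0 \<le> c" "(\<integral>\<^sup>+x. ennreal ((f x)\<^sup>2) \<partial>M) \<le> ennreal (c\<^sup>2)"
  shows "f \<in> L2 M" "L2_norm M f \<le> c"
proof -
  show f: "f \<in> L2 M"
    using assms(1) le_less_trans[OF assms(3) ennreal_less_top] by (simp add: L2_iff_nn_integral)
  have "(L2_norm M f)\<^sup>2 \<le> c\<^sup>2"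
    using assms(3) unfolding L2_nn_integral[OF f] by (simp add: ennreal_le_iff)
  then show "L2_norm M f \<le> c"
    using assms(2) by (rule power2_le_imp_le)
qed

lemma L2_norm_cong_AE:
  assumes "f \<in> borel_measurable M" "g \<in> borel_measurable M" "AE x in M. f x = g x"
  shows "L2_norm M f = L2_norm M g"
proof -
  have "(\<integral>x. (f x)\<^sup>2 \<partial>M) = (\<integral>x. (g x)\<^sup>2 \<partial>M)"
    using assms by (intro integral_cong_AE) auto
  then show ?thesis
    by (simp add: L2_norm_def)
qed

lemma L2_norm_mono:
  assumes "f \<in> L2 M" "g \<in> L2 M" "\<And>x. x \<in> space M \<Longrightarrow> \<bar>f x\<bar> \<le> g x"
  shows "L2_norm M f \<le> L2_norm M g"
proof -
  have "(f x)\<^sup>2 \<le> (g x)\<^sup>2" if "x \<in> space M" for x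
    using assms(3)[OF that] by (simp add: abs_le_square_iff[symmetric])
  then have "(\<integral>x. (f x)\<^sup>2 \<partial>M) \<le> (\<integral>x. (g x)\<^sup>2 \<partial>M)"
    using assms(1,2) by (intro integral_mono L2_integrable_square)
  then show ?thesis
    by (simp add: L2_norm_def)
qed

lemma L2_norm_eq_0_iff:
  assumes "f \<in> L2 M"
  shows "L2_norm M f = 0 \<longleftrightarrow> (AE x in M. f x = 0)"
  using integral_nonneg_eq_0_iff_AE[OF L2_integrable_square[OF assms]] by (simp add: L2_norm_def)

lemma L2_norm_scale: "L2_norm M (\<lambda>x. c * f x) = \<bar>c\<bar> * L2_norm M f"
  by (simp add: L2_norm_def power_mult_distrib real_sqrt_mult)

lemma L2_norm_minus_commute: "L2_norm M (\<lambda>x. f x - g x) = L2_norm M (\<lambda>x. g x - f x)"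
  by (simp add: L2_norm_def power2_commute)

lemma L2_inner_add_left:
  assumes "f \<in> L2 M" "g \<in> L2 M" "h \<in> L2 M"
  shows "L2_inner M (\<lambda>x. f x + g x) h = L2_inner M f h + L2_inner M g h"
  unfolding L2_inner_def using assms by (simp add: distrib_right L2_mult_integrable)

lemma L2_inner_diff_left:
  assumes "f \<in> L2 M" "g \<in> L2 M" "h \<in> L2 M"
  shows "L2_inner M (\<lambda>x. f x - g x) h = L2_inner M f h - L2_inner M g h"
  unfolding L2_inner_def using assms by (simp add: left_diff_distrib L2_mult_integrable)

lemma L2_inner_commute: "L2_inner M f g = L2_inner M g f"
  by (simp add: L2_inner_def mult.commute)

lemma L2_inner_scale_left: "L2_inner M (\<lambda>x. c * f x) g = c * L2_inner M f g"
  by (simp add: L2_inner_def mult.assoc)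

lemma L2_inner_scale_right: "L2_inner M f (\<lambda>x. c * g x) = c * L2_inner M f g"
  by (simp add: L2_inner_def mult.left_commute)

lemma L2_norm_add_square:
  assumes "f \<in> L2 M" "g \<in> L2 M"
  shows "(L2_norm M (\<lambda>x. f x + g x))\<^sup>2 = (L2_norm M f)\<^sup>2 + 2 * L2_inner M f g + (L2_norm M g)\<^sup>2"
  using L2_inner_add_left[OF assms L2_add[OF assms]]
    L2_inner_add_left[OF assms assms(1)] L2_inner_add_left[OF assms assms(2)]
  by (simp add: L2_norm_square_inner L2_inner_commute)

lemma L2_norm_diff_square:
  assumes "f \<in> L2 M" "g \<in> L2 M"
  shows "(L2_norm M (\<lambda>x. f x - g x))\<^sup>2 = (L2_norm M f)\<^sup>2 - 2 * L2_inner M f g + (L2_norm M g)\<^sup>2"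
  using L2_inner_diff_left[OF assms L2_diff[OF assms]]
    L2_inner_diff_left[OF assms assms(1)] L2_inner_diff_left[OF assms assms(2)]
  by (simp add: L2_norm_square_inner L2_inner_commute)

lemma L2_Cauchy_Schwarz:
  assumes "f \<in> L2 M" "g \<in> L2 M"
  shows "\<bar>L2_inner M f g\<bar> \<le> L2_norm M f * L2_norm M g"
proof -
  let ?a = "L2_norm M f" and ?b = "L2_norm M g"
  \<comment> \<open>Expands the nonnegative squared norm of ?b f - s ?a g. With s = 1 and s = -1 one
    computation bounds the inner product from above and from below.\<close>
  have main: "?a * ?b * (s * L2_inner M f g) \<le> ?a * ?b * (?a * ?b)" if s: "s\<^sup>2 = 1" for s :: real
  proof -
    have "0 \<le> (L2_norm M (\<lambda>x. ?b * f x - (s * ?a) * g x))\<^sup>2"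
      by simp
    also have "\<dots> = 2 * ((?a * ?b)\<^sup>2 - ?a * ?b * (s * L2_inner M f g))"
      unfolding L2_norm_diff_square[OF L2_scale[OF assms(1)] L2_scale[OF assms(2)]]
        L2_norm_scale L2_inner_scale_left L2_inner_scale_right
      using s by (simp add: power_mult_distrib algebra_simps)
    finally show ?thesis
      by (simp add: power2_eq_square)
  qed
  have null: "L2_inner M f g = 0" if "?a = 0 \<or> ?b = 0"
  proof -
    have "AE x in M. f x * g x = 0"
      using that assms by (auto simp: L2_norm_eq_0_iff)
    then show ?thesis
      unfolding L2_inner_def by (rule integral_eq_zero_AE)
  qed
  show ?thesis
  proof (cases "?a = 0 \<or> ?b = 0")
    case False
    then have pos: "0 < ?a * ?b"
      using L2_norm_nonneg[of M f] L2_norm_nonneg[of M g] by (auto simp: less_le)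
    have "s * L2_inner M f g \<le> ?a * ?b" if "s\<^sup>2 = 1" for s :: real
      using main[OF that] pos by (simp only: mult_le_cancel_left_pos)
    from this[of 1] this[of "-1"] show ?thesis
      by (simp add: abs_le_iff)
  qed (use null L2_norm_nonneg[of M] in auto)
qed

lemma L2_norm_triangle:
  assumes "f \<in> L2 M" "g \<in> L2 M"
  shows "L2_norm M (\<lambda>x. f x + g x) \<le> L2_norm M f + L2_norm M g"
proof (rule power2_le_imp_le)
  show "(L2_norm M (\<lambda>x. f x + g x))\<^sup>2 \<le> (L2_norm M f + L2_norm M g)\<^sup>2"
    using L2_Cauchy_Schwarz[OF assms] by (simp add: L2_norm_add_square[OF assms] power2_sum)
qed (simp add: L2_norm_nonneg)

lemma L2_norm_triangle_diff:
  assumes "f \<in> L2 M" "g \<in> L2 M" "h \<in> L2 M"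
  shows "L2_norm M (\<lambda>x. f x - h x) \<le> L2_norm M (\<lambda>x. f x - g x) + L2_norm M (\<lambda>x. g x - h x)"
  using L2_norm_triangle[OF L2_diff[OF assms(1,2)] L2_diff[OF assms(2,3)]] by simp

lemma L2_norm_le_diff:
  assumes "f \<in> L2 M" "g \<in> L2 M"
  shows "L2_norm M f \<le> L2_norm M (\<lambda>x. f x - g x) + L2_norm M g"
  using L2_norm_triangle_diff[OF assms L2_zero] by simp

section \<open>Integrability and completeness over a finite measure\<close>

lemma (in finite_measure) L2_integrable: "f \<in> L2 M \<Longrightarrow> integrable M f"
  using L2_mult_integrable[of f M "\<lambda>x. 1"] by (simp add: L2_def)

lemma (in finite_measure) L2_integral_abs_le:
  assumes "f \<in> L2 M"
  shows "(\<integral>x. \<bar>f x\<bar> \<partial>M) \<le> L2_norm M f * sqrt (measure M (space M))"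
proof -
  have "(\<lambda>x. 1) \<in> L2 M"
    by (simp add: L2_def)
  from L2_Cauchy_Schwarz[OF L2_abs[OF assms] this] show ?thesis
    by (simp add: L2_inner_def L2_norm_def)
qed

text \<open>The geometric bound makes the sum of the increments integrable, so the whole sequence
  converges almost everywhere, without passing to a subsequence. The limit is the explicit pointwise
  \<open>lim\<close>: the same formula can then be read over all players at once and in the section
  of a single player.\<close>

lemma (in finite_measure) L2_complete_geometric:
  fixes f :: "nat \<Rightarrow> 'a \<Rightarrow> real"
  assumes f: "\<And>n. f n \<in> L2 M"
    and C: "\<And>n. L2_norm M (\<lambda>x. f (Suc n) x - f n x) \<le> C * r ^ n"
    and r: "0 \<le> r" "r < 1"
  defines "g \<equiv> \<lambda>x. lim (\<lambda>n. f n x)"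
  shows "AE x in M. (\<lambda>n. f n x) \<longlonglongrightarrow> g x"
    and "g \<in> L2 M"
    and "L2_norm M (\<lambda>x. f n x - g x) \<le> C * r ^ n / (1 - r)"
proof -
  note [measurable] = L2_measurable[OF f]
  have C0: "0 \<le> C"
    using C[of 0] L2_norm_nonneg[of M "\<lambda>x. f (Suc 0) x - f 0 x"] by simp
  let ?d = "\<lambda>n x. \<bar>f (Suc n) x - f n x\<bar>"
  let ?m = "sqrt (measure M (space M))"
  \<comment> \<open>Finiteness of the measure enters here: Cauchy-Schwarz against the constant 1
    turns the L2 bound on an increment into an L1 bound.\<close>
  have d: "(\<integral>\<^sup>+x. ennreal (?d n x) \<partial>M) \<le> ennreal (C * ?m * r ^ n)" for n
  proof -
    have i: "(\<lambda>x. f (Suc n) x - f n x) \<in> L2 M"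
      using f by (intro L2_diff)
    have "(\<integral>\<^sup>+x. ennreal (?d n x) \<partial>M) = ennreal (\<integral>x. ?d n x \<partial>M)"
      using L2_integrable[OF i] by (intro nn_integral_eq_integral) auto
    also have "(\<integral>x. ?d n x \<partial>M) \<le> C * r ^ n * ?m"
      using L2_integral_abs_le[OF i] C[of n] by (meson mult_right_mono order.trans real_sqrt_ge_zero measure_nonneg)
    finally show ?thesis
      by (simp add: ennreal_leI mult_ac)
  qed
  have "(\<integral>\<^sup>+x. (\<Sum>n. ennreal (?d n x)) \<partial>M) = (\<Sum>n. \<integral>\<^sup>+x. ennreal (?d n x) \<partial>M)"
    by (rule nn_integral_suminf) measurable
  also have "\<dots> \<le> (\<Sum>n. ennreal (C * ?m * r ^ n))"
    by (intro suminf_le d) auto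
  also have "\<dots> < \<infinity>"
    using C0 r by (subst suminf_ennreal2) (auto intro!: summable_mult summable_geometric)
  finally have "AE x in M. (\<Sum>n. ennreal (?d n x)) \<noteq> \<infinity>"
    by (intro nn_integral_PInf_AE) auto
  then show lim: "AE x in M. (\<lambda>n. f n x) \<longlonglongrightarrow> g x"
  proof eventually_elim
    case (elim x)
    then have "summable (\<lambda>n. ?d n x)"
      by (intro summable_suminf_not_top) auto
    then have "summable (\<lambda>n. f (Suc n) x - f n x)"
      by (rule summable_rabs_cancel)
    then have "convergent (\<lambda>n. \<Sum>i<n. f (Suc i) x - f i x)"
      by (simp add: summable_iff_convergent)
    then have "convergent (\<lambda>n. f n x - f 0 x)"
      using sum_lessThan_telescope[of "\<lambda>n. f n x"] by simp
    then have "convergent (\<lambda>n. (f n x - f 0 x) + f 0 x)"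
      by (intro convergent_add convergent_const)
    then have "convergent (\<lambda>n. f n x)"
      by simp
    then show ?case
      by (simp add: g_def convergent_LIMSEQ_iff)
  qed
  have g[measurable]: "g \<in> borel_measurable M"
    unfolding g_def by measurable
  have step: "L2_norm M (\<lambda>x. f n x - f (n + k) x) \<le> C * r ^ n / (1 - r)" for n k
  proof -
    have "L2_norm M (\<lambda>x. f n x - f (n + k) x) \<le> (\<Sum>i<k. C * r ^ (n + i))"
    proof (induction k)
      case 0
      then show ?case by (simp add: L2_norm_zero)
    next
      case (Suc k)
      have "L2_norm M (\<lambda>x. f n x - f (n + Suc k) x) \<le>
          L2_norm M (\<lambda>x. f n x - f (n + k) x) + L2_norm M (\<lambda>x. f (n + k) x - f (n + Suc k) x)"
        by (intro L2_norm_triangle_diff f)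
      also have "L2_norm M (\<lambda>x. f (n + k) x - f (n + Suc k) x) \<le> C * r ^ (n + k)"
        using C[of "n + k"] by (subst L2_norm_minus_commute) simp
      finally show ?case
        using Suc by simp
    qed
    also have "\<dots> = C * r ^ n * (\<Sum>i<k. r ^ i)"
      by (simp add: sum_distrib_left power_add mult.assoc)
    also have "\<dots> \<le> C * r ^ n * (1 / (1 - r))"
    proof (rule mult_left_mono)
      show "(\<Sum>i<k. r ^ i) \<le> 1 / (1 - r)"
        using sum_le_suminf[OF summable_geometric, of r "{..<k}"] r by (simp add: suminf_geometric)
    qed (use C0 r in simp)
    finally show ?thesis
      by simp
  qed
  have fg: "(\<lambda>x. f n x - g x) \<in> L2 M \<and> L2_norm M (\<lambda>x. f n x - g x) \<le> C * r ^ n / (1 - r)" for n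
  proof -
    let ?c = "C * r ^ n / (1 - r)"
    have c: "0 \<le> ?c"
      using C0 r by simp
    \<comment> \<open>Fatou's lemma in k: the bound \<open>step\<close> does not depend on k, so it
      survives the almost everywhere limit.\<close>
    have "(\<integral>\<^sup>+x. ennreal ((f n x - g x)\<^sup>2) \<partial>M) = (\<integral>\<^sup>+x. liminf (\<lambda>k. ennreal ((f n x - f (n + k) x)\<^sup>2)) \<partial>M)"
    proof (rule nn_integral_cong_AE, use lim in eventually_elim)
      case (elim x)
      then have "(\<lambda>k. f (n + k) x) \<longlonglongrightarrow> g x"
        using LIMSEQ_ignore_initial_segment[of "\<lambda>k. f k x" _ n] by (simp add: add.commute)
      then have "(\<lambda>k. ennreal ((f n x - f (n + k) x)\<^sup>2)) \<longlonglongrightarrow> ennreal ((f n x - g x)\<^sup>2)"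
        by (intro tendsto_intros)
      then show ?case
        by (intro lim_imp_Liminf[symmetric] sequentially_bot)
    qed
    also have "\<dots> \<le> liminf (\<lambda>k. \<integral>\<^sup>+x. ennreal ((f n x - f (n + k) x)\<^sup>2) \<partial>M)"
      by (rule nn_integral_liminf) measurable
    also have "\<dots> \<le> liminf (\<lambda>k::nat. ennreal (?c\<^sup>2))"
    proof (rule Liminf_mono, rule always_eventually, rule allI)
      fix k
      have "(\<integral>\<^sup>+x. ennreal ((f n x - f (n + k) x)\<^sup>2) \<partial>M) = ennreal ((L2_norm M (\<lambda>x. f n x - f (n + k) x))\<^sup>2)"
        by (intro L2_nn_integral L2_diff f)
      also have "\<dots> \<le> ennreal (?c\<^sup>2)"
        by (intro ennreal_leI power_mono step L2_norm_nonneg)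
      finally show "(\<integral>\<^sup>+x. ennreal ((f n x - f (n + k) x)\<^sup>2) \<partial>M) \<le> ennreal (?c\<^sup>2)" .
    qed
    also have "\<dots> = ennreal (?c\<^sup>2)"
      by (simp add: Liminf_const)
    finally show ?thesis
      using L2_norm_leI[OF _ c, of "\<lambda>x. f n x - g x" M] by auto
  qed
  then show "L2_norm M (\<lambda>x. f n x - g x) \<le> C * r ^ n / (1 - r)"
    by blast
  show "g \<in> L2 M"
    using L2_diff[OF f[of 0] conjunct1[OF fg[of 0]]] by simp
qed

section \<open>The graphon operator and its largest eigenvalue\<close>

text \<open>The second coordinate is the one held fixed, because the graphon operator acts on the
  first. Only almost every section is square-integrable.\<close>

lemma L2_pair_sections:
  assumes "sigma_finite_measure N" "sigma_finite_measure M" and a: "a \<in> L2 (N \<Otimes>\<^sub>M M)"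
  shows "AE m in M. (\<lambda>x. a (x, m)) \<in> L2 N"
    and "integrable M (\<lambda>m. (L2_norm N (\<lambda>x. a (x, m)))\<^sup>2)"
    and "(L2_norm (N \<Otimes>\<^sub>M M) a)\<^sup>2 = (\<integral>m. (L2_norm N (\<lambda>x. a (x, m)))\<^sup>2 \<partial>M)"
proof -
  interpret pair_sigma_finite N M
    using assms by (simp add: pair_sigma_finite_def)
  note [measurable] = L2_measurable[OF a]
  have int: "integrable (N \<Otimes>\<^sub>M M) (\<lambda>(x, m). (a (x, m))\<^sup>2)"
    using L2_integrable_square[OF a] by (simp add: case_prod_beta')
  show "AE m in M. (\<lambda>x. a (x, m)) \<in> L2 N"
    using AE_integrable_snd[OF int] AE_space by eventually_elim (auto simp: L2_def)
  show "integrable M (\<lambda>m. (L2_norm N (\<lambda>x. a (x, m)))\<^sup>2)"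
    using integrable_snd[OF int] by (simp add: L2_norm_square)
  show "(L2_norm (N \<Otimes>\<^sub>M M) a)\<^sup>2 = (\<integral>m. (L2_norm N (\<lambda>x. a (x, m)))\<^sup>2 \<partial>M)"
    using integral_snd[OF int] by (simp add: L2_norm_square case_prod_beta')
qed

lemma L2_inner_pair:
  assumes "sigma_finite_measure N" "sigma_finite_measure M"
    and "a \<in> L2 (N \<Otimes>\<^sub>M M)" "b \<in> L2 (N \<Otimes>\<^sub>M M)"
  shows "L2_inner (N \<Otimes>\<^sub>M M) a b = (\<integral>m. L2_inner N (\<lambda>x. a (x, m)) (\<lambda>x. b (x, m)) \<partial>M)"
proof -
  interpret pair_sigma_finite N M
    using assms by (simp add: pair_sigma_finite_def)
  have "integrable (N \<Otimes>\<^sub>M M) (\<lambda>(x, m). a (x, m) * b (x, m))"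
    using L2_mult_integrable[OF assms(3,4)] by (simp add: case_prod_beta')
  from integral_snd[OF this] show ?thesis
    by (simp add: L2_inner_def case_prod_beta')
qed

lemma (in pair_prob_space) L2_fst:
  assumes "f \<in> L2 M1"
  shows "(\<lambda>z. f (fst z)) \<in> L2 (M1 \<Otimes>\<^sub>M M2)"
proof -
  note [measurable] = L2_measurable[OF assms]
  have "(\<integral>\<^sup>+z. ennreal ((f (fst z))\<^sup>2) \<partial>(M1 \<Otimes>\<^sub>M M2)) = (\<integral>\<^sup>+x. ennreal ((f x)\<^sup>2) \<partial>M1)"
    by (subst M2.nn_integral_fst[symmetric]) (auto simp: M2.emeasure_space_1)
  then show ?thesis
    using assms by (simp add: L2_iff_nn_integral)
qed

lemma (in pair_prob_space) L2_snd:
  assumes "f \<in> L2 M2"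
  shows "(\<lambda>z. f (snd z)) \<in> L2 (M1 \<Otimes>\<^sub>M M2)"
proof -
  note [measurable] = L2_measurable[OF assms]
  have "(\<integral>\<^sup>+z. ennreal ((f (snd z))\<^sup>2) \<partial>(M1 \<Otimes>\<^sub>M M2)) = (\<integral>\<^sup>+x. ennreal ((f x)\<^sup>2) \<partial>M2)"
    by (subst M2.nn_integral_fst[symmetric]) (auto simp: M1.emeasure_space_1)
  then show ?thesis
    using assms by (simp add: L2_iff_nn_integral)
qed

section \<open>The operator of a symmetric kernel with values in [0,1]\<close>

locale kernel_operator = prob_space N for N :: "real measure" +
  fixes W :: "real \<Rightarrow> real \<Rightarrow> real"
  assumes W_measurable[measurable]: "case_prod W \<in> borel_measurable (N \<Otimes>\<^sub>M N)"
    and W_nonneg: "\<And>x y. x \<in> space N \<Longrightarrow> y \<in> space N \<Longrightarrow> 0 \<le> W x y"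
    and W_le_1: "\<And>x y. x \<in> space N \<Longrightarrow> y \<in> space N \<Longrightarrow> W x y \<le> 1"
    and W_sym: "\<And>x y. x \<in> space N \<Longrightarrow> y \<in> space N \<Longrightarrow> W x y = W y x"
begin

sublocale NN: pair_prob_space N N ..

abbreviation K :: "(real \<Rightarrow> real) \<Rightarrow> real \<Rightarrow> real" where
  "K \<equiv> graphon_op N W"

lemma W_square_le_1: "x \<in> space N \<Longrightarrow> y \<in> space N \<Longrightarrow> (W x y)\<^sup>2 \<le> 1"
  by (simp add: W_nonneg W_le_1 power_le_one)

lemma W_section_L2:
  assumes x: "x \<in> space N"
  shows "W x \<in> L2 N"
proof (rule L2_dominated)
  show "W x \<in> borel_measurable N"
    using measurable_compose[OF measurable_Pair1'[OF x] W_measurable] by simp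
  show "(W x y)\<^sup>2 \<le> (1::real)" if "y \<in> space N" for y
    using x that by (rule W_square_le_1)
qed simp

lemma W_section_norm_le_1:
  assumes x: "x \<in> space N"
  shows "L2_norm N (W x) \<le> 1"
proof -
  have "(\<integral>y. (W x y)\<^sup>2 \<partial>N) \<le> (\<integral>y. 1 \<partial>N)"
    using W_section_L2[OF x] x by (intro integral_mono L2_integrable_square) (auto simp: W_square_le_1)
  then show ?thesis
    by (simp add: L2_norm_def prob_space)
qed

lemma K_integrable: "x \<in> space N \<Longrightarrow> f \<in> L2 N \<Longrightarrow> integrable N (\<lambda>y. W x y * f y)"
  by (intro L2_mult_integrable W_section_L2)

lemma K_measurable[measurable]:
  assumes [measurable]: "f \<in> borel_measurable N"
  shows "K f \<in> borel_measurable N"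
  unfolding graphon_op_def by measurable

text \<open>Cauchy-Schwarz with the section \<open>W x\<close>, whose norm is at most 1. The bound
  holds at every x, which later gives estimates for each single player.\<close>

lemma K_abs_le:
  assumes "x \<in> space N" "f \<in> L2 N"
  shows "\<bar>K f x\<bar> \<le> L2_norm N f"
proof -
  have "\<bar>K f x\<bar> \<le> L2_norm N (W x) * L2_norm N f"
    using L2_Cauchy_Schwarz[OF W_section_L2[OF assms(1)] assms(2)] by (simp add: graphon_op_def L2_inner_def)
  also have "\<dots> \<le> 1 * L2_norm N f"
    using assms by (intro mult_right_mono W_section_norm_le_1 L2_norm_nonneg)
  finally show ?thesis
    by simp
qed

lemma K_L2:
  assumes "f \<in> L2 N"
  shows "K f \<in> L2 N"
proof (rule L2_dominated)
  show "(K f x)\<^sup>2 \<le> (L2_norm N f)\<^sup>2" if "x \<in> space N" for x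
    using K_abs_le[OF that assms] by (simp add: abs_le_square_iff[symmetric] L2_norm_nonneg)
qed (simp_all add: K_measurable[OF L2_measurable[OF assms]])

lemma K_norm_le:
  assumes "f \<in> L2 N"
  shows "L2_norm N (K f) \<le> L2_norm N f"
proof -
  have "(\<integral>x. (K f x)\<^sup>2 \<partial>N) \<le> (\<integral>x. (L2_norm N f)\<^sup>2 \<partial>N)"
    using K_abs_le[OF _ assms]
    by (intro integral_mono L2_integrable_square[OF K_L2[OF assms]] integrable_const) (auto simp: abs_le_square_iff[symmetric] L2_norm_nonneg)
  then have "(L2_norm N (K f))\<^sup>2 \<le> (L2_norm N f)\<^sup>2"
    by (simp add: L2_norm_square prob_space)
  then show ?thesis
    by (rule power2_le_imp_le) (rule L2_norm_nonneg)
qed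

lemma K_add: "x \<in> space N \<Longrightarrow> f \<in> L2 N \<Longrightarrow> g \<in> L2 N \<Longrightarrow> K (\<lambda>y. f y + g y) x = K f x + K g x"
  using K_integrable by (simp add: graphon_op_def distrib_left)

lemma K_diff: "x \<in> space N \<Longrightarrow> f \<in> L2 N \<Longrightarrow> g \<in> L2 N \<Longrightarrow> K (\<lambda>y. f y - g y) x = K f x - K g x"
  using K_integrable by (simp add: graphon_op_def right_diff_distrib)

lemma K_scale: "K (\<lambda>y. c * f y) x = c * K f x"
  by (simp add: graphon_op_def mult.left_commute[of _ c])

lemma K_symmetric:
  assumes "f \<in> L2 N" "g \<in> L2 N"
  shows "L2_inner N (K f) g = L2_inner N f (K g)"
proof -
  note [measurable] = L2_measurable[OF assms(1)] L2_measurable[OF assms(2)]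
  have int: "integrable (N \<Otimes>\<^sub>M N) (\<lambda>(x, y). W x y * f y * g x)"
  proof (rule Bochner_Integration.integrable_bound[OF L2_mult_integrable])
    show "(\<lambda>z. f (snd z)) \<in> L2 (N \<Otimes>\<^sub>M N)" "(\<lambda>z. g (fst z)) \<in> L2 (N \<Otimes>\<^sub>M N)"
      using assms by (auto intro: NN.L2_fst NN.L2_snd)
    show "AE z in N \<Otimes>\<^sub>M N. norm (case z of (x, y) \<Rightarrow> W x y * f y * g x) \<le> norm (f (snd z) * g (fst z))"
      by (rule AE_I2) (auto simp: space_pair_measure abs_mult W_nonneg W_le_1 mult.assoc intro!: mult_left_le_one_le)
  qed measurable
  have "L2_inner N (K f) g = (\<integral>x. \<integral>y. W x y * f y * g x \<partial>N \<partial>N)"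
    by (simp add: L2_inner_def graphon_op_def)
  also have "\<dots> = (\<integral>y. \<integral>x. W x y * f y * g x \<partial>N \<partial>N)"
    using NN.Fubini_integral[OF int] by simp
  also have "\<dots> = (\<integral>y. \<integral>x. f y * (W y x * g x) \<partial>N \<partial>N)"
    by (intro Bochner_Integration.integral_cong refl) (simp add: W_sym)
  also have "\<dots> = L2_inner N f (K g)"
    by (simp add: L2_inner_def graphon_op_def)
  finally show ?thesis .
qed

section \<open>The operator norm\<close>

definition op_norm :: real where
  "op_norm = (SUP f\<in>{f \<in> L2 N. L2_norm N f \<le> 1}. L2_norm N (K f))"

lemma op_norm_upper:
  assumes "f \<in> L2 N" "L2_norm N f \<le> 1"
  shows "L2_norm N (K f) \<le> op_norm"
  unfolding op_norm_def
proof (rule cSUP_upper)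
  show "bdd_above ((\<lambda>f. L2_norm N (K f)) ` {f \<in> L2 N. L2_norm N f \<le> 1})"
    by (rule bdd_aboveI2[of _ _ 1]) (use K_norm_le in force)
qed (use assms in simp)

lemma op_norm_nonneg: "0 \<le> op_norm"
  using op_norm_upper[OF L2_zero] L2_norm_nonneg[of N "K (\<lambda>x. 0)"] by (simp add: L2_norm_zero)

lemma op_norm_le_1: "op_norm \<le> 1"
  unfolding op_norm_def
proof (rule cSUP_least)
  \<comment> \<open>The closed unit ball contains the zero function, so the supremum makes sense
    before any unit vector has been produced.\<close>
  show "{f \<in> L2 N. L2_norm N f \<le> 1} \<noteq> {}"
    using L2_zero[of N] L2_norm_zero[of N] by (auto intro!: exI[of _ "\<lambda>x. 0"])
qed (use K_norm_le in force)

lemma K_op_norm: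
  assumes "f \<in> L2 N"
  shows "L2_norm N (K f) \<le> op_norm * L2_norm N f"
proof (cases "L2_norm N f = 0")
  case True
  then show ?thesis
    using K_norm_le[OF assms] by simp
next
  case False
  let ?n = "L2_norm N f"
  have n: "0 < ?n"
    using False L2_norm_nonneg[of N f] by simp
  have "L2_norm N (K (\<lambda>x. (1 / ?n) * f x)) \<le> op_norm"
    using n by (intro op_norm_upper L2_scale assms) (simp only: L2_norm_scale, simp)
  then have "L2_norm N (K f) / ?n \<le> op_norm"
    using n unfolding K_scale L2_norm_scale by simp
  then show ?thesis
    using n by (simp add: field_simps)
qed

text \<open>This is the tensor product of \<open>K\<close> with the identity. On kernels it is
  composition with \<open>K\<close> from the left; on profiles, where m = (t, w), it is the local
  aggregate.\<close>

definition lift :: "(real \<times> 'b \<Rightarrow> real) \<Rightarrow> real \<times> 'b \<Rightarrow> real" where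
  "lift a = (\<lambda>(x, m). K (\<lambda>y. a (y, m)) x)"

lemma lift_measurable[measurable]:
  assumes [measurable]: "a \<in> borel_measurable (N \<Otimes>\<^sub>M M)"
  shows "lift a \<in> borel_measurable (N \<Otimes>\<^sub>M M)"
  unfolding lift_def graphon_op_def by measurable

text \<open>\<open>K_op_norm\<close> is applied in each fibre and integrated over m. The difference
  of the lifts is kept because it agrees with the lift of the difference only for almost every m: at
  other m the integrals may take their default value 0.\<close>

lemma lift_diff_norm:
  assumes M: "sigma_finite_measure M" and ab: "a \<in> L2 (N \<Otimes>\<^sub>M M)" "b \<in> L2 (N \<Otimes>\<^sub>M M)"
  shows "(\<lambda>z. lift a z - lift b z) \<in> L2 (N \<Otimes>\<^sub>M M)"
    and "L2_norm (N \<Otimes>\<^sub>M M) (\<lambda>z. lift a z - lift b z) \<le> op_norm * L2_norm (N \<Otimes>\<^sub>M M) (\<lambda>z. a z - b z)"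
proof -
  have sf: "sigma_finite_measure N"
    by (rule sigma_finite_measure_axioms)
  interpret M: sigma_finite_measure M by fact
  interpret pair_sigma_finite N M ..
  note [measurable] = L2_measurable[OF ab(1)] L2_measurable[OF ab(2)]
  let ?d = "\<lambda>z. a z - b z"
  have d: "?d \<in> L2 (N \<Otimes>\<^sub>M M)"
    using ab by (rule L2_diff)
  have meas[measurable]: "(\<lambda>z. lift a z - lift b z) \<in> borel_measurable (N \<Otimes>\<^sub>M M)"
    by measurable
  have "(\<integral>\<^sup>+z. ennreal ((lift a z - lift b z)\<^sup>2) \<partial>(N \<Otimes>\<^sub>M M))
      = (\<integral>\<^sup>+m. (\<integral>\<^sup>+x. ennreal ((lift a (x, m) - lift b (x, m))\<^sup>2) \<partial>N) \<partial>M)"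
    by (rule nn_integral_snd[symmetric, where f = "\<lambda>z. ennreal ((lift a z - lift b z)\<^sup>2)"]) measurable
  also have "\<dots> \<le> (\<integral>\<^sup>+m. ennreal (op_norm\<^sup>2) * ennreal ((L2_norm N (\<lambda>x. ?d (x, m)))\<^sup>2) \<partial>M)"
  proof (rule nn_integral_mono_AE)
    show "AE m in M. (\<integral>\<^sup>+x. ennreal ((lift a (x, m) - lift b (x, m))\<^sup>2) \<partial>N)
        \<le> ennreal (op_norm\<^sup>2) * ennreal ((L2_norm N (\<lambda>x. ?d (x, m)))\<^sup>2)"
      using L2_pair_sections(1)[OF sf M ab(1)] L2_pair_sections(1)[OF sf M ab(2)]
    proof eventually_elim
      case (elim m)
      note dm = L2_diff[OF elim]
      have "(\<integral>\<^sup>+x. ennreal ((lift a (x, m) - lift b (x, m))\<^sup>2) \<partial>N)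
          = (\<integral>\<^sup>+x. ennreal ((K (\<lambda>x. ?d (x, m)) x)\<^sup>2) \<partial>N)"
        using elim by (intro nn_integral_cong) (simp add: lift_def K_diff)
      also have "\<dots> = ennreal ((L2_norm N (K (\<lambda>x. ?d (x, m))))\<^sup>2)"
        by (intro L2_nn_integral K_L2 dm)
      also have "\<dots> \<le> ennreal ((op_norm * L2_norm N (\<lambda>x. ?d (x, m)))\<^sup>2)"
        by (intro ennreal_leI power_mono K_op_norm dm L2_norm_nonneg)
      finally show ?case
        by (simp add: power_mult_distrib ennreal_mult)
    qed
  qed
  also have "\<dots> = ennreal (op_norm\<^sup>2) * (\<integral>\<^sup>+m. ennreal ((L2_norm N (\<lambda>x. ?d (x, m)))\<^sup>2) \<partial>M)"
    by (rule nn_integral_cmult)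
      (rule measurable_compose[OF borel_measurable_integrable[OF L2_pair_sections(2)[OF sf M d]] measurable_ennreal])
  also have "(\<integral>\<^sup>+m. ennreal ((L2_norm N (\<lambda>x. ?d (x, m)))\<^sup>2) \<partial>M) = ennreal ((L2_norm (N \<Otimes>\<^sub>M M) ?d)\<^sup>2)"
    unfolding L2_pair_sections(3)[OF sf M d]
    by (intro nn_integral_eq_integral L2_pair_sections(2)[OF sf M d]) simp
  also have "ennreal (op_norm\<^sup>2) * \<dots> = ennreal ((op_norm * L2_norm (N \<Otimes>\<^sub>M M) ?d)\<^sup>2)"
    by (simp add: power_mult_distrib ennreal_mult)
  finally have le: "(\<integral>\<^sup>+z. ennreal ((lift a z - lift b z)\<^sup>2) \<partial>(N \<Otimes>\<^sub>M M)) \<le> ennreal ((op_norm * L2_norm (N \<Otimes>\<^sub>M M) ?d)\<^sup>2)" .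
  have "0 \<le> op_norm * L2_norm (N \<Otimes>\<^sub>M M) ?d"
    by (simp add: op_norm_nonneg L2_norm_nonneg)
  from L2_norm_leI[OF meas this le]
  show "(\<lambda>z. lift a z - lift b z) \<in> L2 (N \<Otimes>\<^sub>M M)"
    and "L2_norm (N \<Otimes>\<^sub>M M) (\<lambda>z. lift a z - lift b z) \<le> op_norm * L2_norm (N \<Otimes>\<^sub>M M) ?d" .
qed

lemma lift_zero: "lift (\<lambda>z. 0) = (\<lambda>z. 0)"
  by (simp add: lift_def graphon_op_def fun_eq_iff)

lemma lift_L2:
  assumes "sigma_finite_measure M" "a \<in> L2 (N \<Otimes>\<^sub>M M)"
  shows "lift a \<in> L2 (N \<Otimes>\<^sub>M M)"
    and "L2_norm (N \<Otimes>\<^sub>M M) (lift a) \<le> op_norm * L2_norm (N \<Otimes>\<^sub>M M) a"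
  using lift_diff_norm[OF assms L2_zero] by (simp_all add: lift_zero)

lemma lift_symmetric:
  assumes M: "sigma_finite_measure M" and ab: "a \<in> L2 (N \<Otimes>\<^sub>M M)" "b \<in> L2 (N \<Otimes>\<^sub>M M)"
  shows "L2_inner (N \<Otimes>\<^sub>M M) (lift a) b = L2_inner (N \<Otimes>\<^sub>M M) a (lift b)"
proof -
  note sf = sigma_finite_measure_axioms M
  have "L2_inner (N \<Otimes>\<^sub>M M) (lift a) b = (\<integral>m. L2_inner N (K (\<lambda>x. a (x, m))) (\<lambda>x. b (x, m)) \<partial>M)"
    by (subst L2_inner_pair[OF sf lift_L2(1)[OF M ab(1)] ab(2)]) (simp add: lift_def)
  also have "\<dots> = (\<integral>m. L2_inner N (\<lambda>x. a (x, m)) (K (\<lambda>x. b (x, m))) \<partial>M)"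
  proof (rule integral_cong_AE)
    show "AE m in M. L2_inner N (K (\<lambda>x. a (x, m))) (\<lambda>x. b (x, m)) = L2_inner N (\<lambda>x. a (x, m)) (K (\<lambda>x. b (x, m)))"
      using L2_pair_sections(1)[OF sf ab(1)] L2_pair_sections(1)[OF sf ab(2)]
      by eventually_elim (rule K_symmetric)
    note [measurable] = L2_measurable[OF ab(1)] L2_measurable[OF ab(2)]
    show "(\<lambda>m. L2_inner N (K (\<lambda>x. a (x, m))) (\<lambda>x. b (x, m))) \<in> borel_measurable M"
      "(\<lambda>m. L2_inner N (\<lambda>x. a (x, m)) (K (\<lambda>x. b (x, m)))) \<in> borel_measurable M"
      unfolding L2_inner_def graphon_op_def by measurable
  qed
  also have "\<dots> = L2_inner (N \<Otimes>\<^sub>M M) a (lift b)"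
    by (subst L2_inner_pair[OF sf ab(1) lift_L2(1)[OF M ab(2)]]) (simp add: lift_def)
  finally show ?thesis .
qed

section \<open>Iterated kernels\<close>

fun kernel_power :: "nat \<Rightarrow> real \<times> real \<Rightarrow> real" where
  "kernel_power 0 = case_prod W"
| "kernel_power (Suc n) = (\<lambda>z. (1 / op_norm) * lift (kernel_power n) z)"

lemma kernel_power_nonneg:
  "x \<in> space N \<Longrightarrow> y \<in> space N \<Longrightarrow> 0 \<le> kernel_power n (x, y)"
proof (induction n arbitrary: x y)
  case (Suc n)
  then show ?case
    by (auto simp: lift_def graphon_op_def op_norm_nonneg W_nonneg intro!: divide_nonneg_nonneg integral_nonneg_AE AE_I2)
qed (simp add: W_nonneg)

lemma kernel_power_L2: "kernel_power n \<in> L2 (N \<Otimes>\<^sub>M N)"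
proof (induction n)
  case 0
  have "integrable (N \<Otimes>\<^sub>M N) (\<lambda>z. 1 :: real)"
    by simp
  then show ?case
    by (auto intro!: L2_dominated[where g = "\<lambda>z. 1"] simp: space_pair_measure W_square_le_1)
next
  case (Suc n)
  then show ?case
    by (simp only: kernel_power.simps) (intro L2_scale lift_L2 sigma_finite_measure_axioms)
qed

lemma kernel_power_inner_shift:
  "L2_inner (N \<Otimes>\<^sub>M N) (kernel_power (Suc j)) (kernel_power k)
    = L2_inner (N \<Otimes>\<^sub>M N) (kernel_power j) (kernel_power (Suc k))"
  by (simp only: kernel_power.simps L2_inner_scale_left L2_inner_scale_right)
    (simp only: lift_symmetric[OF sigma_finite_measure_axioms kernel_power_L2 kernel_power_L2])

lemma kernel_power_inner_add:
  "L2_inner (N \<Otimes>\<^sub>M N) (kernel_power j) (kernel_power k)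
    = L2_inner (N \<Otimes>\<^sub>M N) (kernel_power 0) (kernel_power (j + k))"
proof (induction j arbitrary: k)
  case (Suc j)
  show ?case
    unfolding kernel_power_inner_shift Suc by simp
qed simp

lemma scaled_lift_diff_norm:
  assumes pos: "0 < op_norm" and "a \<in> L2 (N \<Otimes>\<^sub>M N)" "b \<in> L2 (N \<Otimes>\<^sub>M N)"
  shows "L2_norm (N \<Otimes>\<^sub>M N) (\<lambda>z. 1 / op_norm * lift a z - 1 / op_norm * lift b z)
    \<le> L2_norm (N \<Otimes>\<^sub>M N) (\<lambda>z. a z - b z)"
proof -
  have "L2_norm (N \<Otimes>\<^sub>M N) (\<lambda>z. 1 / op_norm * lift a z - 1 / op_norm * lift b z)
      = 1 / op_norm * L2_norm (N \<Otimes>\<^sub>M N) (\<lambda>z. lift a z - lift b z)"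
    using pos L2_norm_scale[of _ "1 / op_norm" "\<lambda>z. lift a z - lift b z"] by (simp add: right_diff_distrib)
  also have "\<dots> \<le> 1 / op_norm * (op_norm * L2_norm (N \<Otimes>\<^sub>M N) (\<lambda>z. a z - b z))"
    using pos by (intro mult_left_mono lift_diff_norm assms sigma_finite_measure_axioms) auto
  finally show ?thesis
    using pos by simp
qed

lemma kernel_power_norm_decreasing:
  assumes "0 < op_norm"
  shows "L2_norm (N \<Otimes>\<^sub>M N) (kernel_power (Suc n)) \<le> L2_norm (N \<Otimes>\<^sub>M N) (kernel_power n)"
  using scaled_lift_diff_norm[OF assms kernel_power_L2 L2_zero] by (simp add: lift_zero)

text \<open>Index 0 is \<open>W\<close> itself, hence the shift: \<open>kernel_power n\<close> is
  the kernel of K^(n+1) / op_norm^n. This is the link between its Hilbert-Schmidt norm and the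
  powers of \<open>K\<close>.\<close>

lemma kernel_power_apply:
  assumes f: "f \<in> L2 N" and x: "x \<in> space N"
  shows "(\<integral>y. kernel_power n (x, y) * f y \<partial>N) = (1 / op_norm) ^ n * (K ^^ Suc n) f x"
  using x
proof (induction n arbitrary: x)
  case 0
  then show ?case
    by (simp add: graphon_op_def)
next
  case (Suc n)
  note [measurable] = L2_measurable[OF f] L2_measurable[OF kernel_power_L2[of n]]
  have int: "integrable (N \<Otimes>\<^sub>M N) (\<lambda>(u, y). W x u * kernel_power n (u, y) * f y)"
  proof (rule Bochner_Integration.integrable_bound[OF L2_mult_integrable[OF kernel_power_L2[of n] NN.L2_snd[OF f]]])
    have "W x \<in> borel_measurable N"
      using W_section_L2[OF Suc.prems] by (rule L2_measurable)
    note [measurable] = this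
    show "(\<lambda>(u, y). W x u * kernel_power n (u, y) * f y) \<in> borel_measurable (N \<Otimes>\<^sub>M N)"
      by measurable
    show "AE z in N \<Otimes>\<^sub>M N. norm (case z of (u, y) \<Rightarrow> W x u * kernel_power n (u, y) * f y)
        \<le> norm (kernel_power n z * f (snd z))"
      using Suc.prems
      by (intro AE_I2) (auto simp: space_pair_measure abs_mult W_nonneg W_le_1 mult.assoc intro!: mult_left_le_one_le)
  qed
  have "(\<integral>y. kernel_power (Suc n) (x, y) * f y \<partial>N)
      = (1 / op_norm) * (\<integral>y. (\<integral>u. W x u * kernel_power n (u, y) * f y \<partial>N) \<partial>N)"
    by (simp add: lift_def graphon_op_def)
  also have "(\<integral>y. (\<integral>u. W x u * kernel_power n (u, y) * f y \<partial>N) \<partial>N)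
      = (\<integral>u. (\<integral>y. W x u * kernel_power n (u, y) * f y \<partial>N) \<partial>N)"
    by (rule NN.Fubini_integral[OF int])
  also have "\<dots> = (\<integral>u. W x u * ((1 / op_norm) ^ n * (K ^^ Suc n) f u) \<partial>N)"
    by (intro Bochner_Integration.integral_cong refl) (simp add: mult.assoc Suc.IH[simplified])
  also have "\<dots> = (1 / op_norm) ^ n * (\<integral>u. W x u * (K ^^ Suc n) f u \<partial>N)"
    by (subst integral_mult_right_zero[symmetric]) (simp only: mult_ac)
  also have "(\<integral>u. W x u * (K ^^ Suc n) f u \<partial>N) = (K ^^ Suc (Suc n)) f x"
    unfolding funpow.simps(2)[of "Suc n"] o_apply graphon_op_def[of N W "(K ^^ Suc n) f" x] ..
  finally show ?case
    by simp
qed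

lemma K_power_L2: "f \<in> L2 N \<Longrightarrow> (K ^^ n) f \<in> L2 N"
  by (induction n) (auto intro: K_L2)

text \<open>Log-convexity of \<open>n \<mapsto> \<parallel>K\<^sup>n f\<parallel>\<close>, which holds because \<open>K\<close> is symmetric.\<close>

lemma K_power_norm_ge:
  assumes f: "f \<in> L2 N" "L2_norm N f = 1"
  shows "L2_norm N (K f) ^ n \<le> L2_norm N ((K ^^ n) f)"
proof -
  let ?p = "\<lambda>n. L2_norm N ((K ^^ n) f)"
  note p0 = L2_norm_nonneg
  have log_convex: "(?p (Suc n))\<^sup>2 \<le> ?p n * ?p (Suc (Suc n))" for n
  proof -
    have "(?p (Suc n))\<^sup>2 = L2_inner N ((K ^^ n) f) ((K ^^ Suc (Suc n)) f)"
      using K_symmetric[OF K_power_L2[OF f(1), of n] K_power_L2[OF f(1), of "Suc n"]]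
      by (simp add: L2_norm_square_inner)
    also have "\<dots> \<le> ?p n * ?p (Suc (Suc n))"
      using L2_Cauchy_Schwarz[OF K_power_L2[OF f(1)] K_power_L2[OF f(1)]] abs_le_D1 by blast
    finally show ?thesis .
  qed
  \<comment> \<open>Log-convexity makes the ratios of successive norms nondecreasing, and the first
    ratio is \<open>?p 1\<close> because \<open>?p 0 = 1\<close>. The cross-multiplied form avoids
    dividing by a norm that may vanish.\<close>
  have ratio: "?p 1 * ?p n \<le> ?p (Suc n)" for n
  proof (induction n)
    case (Suc n)
    show ?case
    proof (cases "?p (Suc n) = 0")
      case False
      then have pos: "0 < ?p (Suc n)"
        using p0[of N "(K ^^ Suc n) f"] by simp
      then have "0 < ?p n"
        using log_convex[of n] p0[of N "(K ^^ n) f"] by (cases "?p n = 0") (auto simp del: funpow.simps)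
      have "(?p 1 * ?p (Suc n)) * ?p n \<le> ?p (Suc n) * ?p (Suc n)"
        using mult_right_mono[OF Suc L2_norm_nonneg[of N "(K ^^ Suc n) f"]] by (simp add: mult_ac del: funpow.simps)
      also have "\<dots> \<le> ?p (Suc (Suc n)) * ?p n"
        using log_convex[of n] by (simp add: power2_eq_square mult_ac del: funpow.simps)
      finally show ?thesis
        using \<open>0 < ?p n\<close> by (simp only: mult_le_cancel_right_pos)
    qed (use p0 in \<open>simp del: funpow.simps\<close>)
  qed (simp add: f)
  show ?thesis
  proof (induction n)
    case (Suc n)
    have "L2_norm N (K f) ^ Suc n \<le> ?p 1 * ?p n"
      using mult_left_mono[OF Suc L2_norm_nonneg[of N "K f"]] by simp
    with ratio[of n] show ?case
      by linarith
  qed (simp add: f)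
qed

text \<open>The Hilbert-Schmidt norm dominates the operator norm, and K^(n+1) / op_norm^n has
  operator norm at least op_norm by \<open>K_power_norm_ge\<close>. The bound is uniform in n and
  keeps the limit kernel from vanishing.\<close>

lemma kernel_power_norm_ge:
  assumes pos: "0 < op_norm"
  shows "op_norm \<le> L2_norm (N \<Otimes>\<^sub>M N) (kernel_power n)"
proof -
  let ?B = "kernel_power n"
  note sf = sigma_finite_measure_axioms
  have bound: "L2_norm N ((K ^^ Suc n) f) \<le> op_norm ^ n * L2_norm (N \<Otimes>\<^sub>M N) ?B"
    if f: "f \<in> L2 N" "L2_norm N f = 1" for f
  proof -
    note [measurable] = L2_measurable[OF kernel_power_L2[of n]]
    \<comment> \<open>\<open>L2_pair_sections\<close> fixes the second coordinate, whereas here the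
      first one, x, is fixed; the kernel is therefore transposed.\<close>
    have B': "(\<lambda>(y, x). ?B (x, y)) \<in> L2 (N \<Otimes>\<^sub>M N)"
    proof -
      have "(\<integral>\<^sup>+z. ennreal ((case z of (y, x) \<Rightarrow> ?B (x, y))\<^sup>2) \<partial>(N \<Otimes>\<^sub>M N)) = (\<integral>\<^sup>+z. ennreal ((?B z)\<^sup>2) \<partial>(N \<Otimes>\<^sub>M N))"
        by (subst (2) NN.distr_pair_swap, subst nn_integral_distr) (auto simp: case_prod_beta' intro!: nn_integral_cong)
      then show ?thesis
        using kernel_power_L2[of n] by (simp add: L2_iff_nn_integral)
    qed
    have norm': "L2_norm (N \<Otimes>\<^sub>M N) (\<lambda>(y, x). ?B (x, y)) = L2_norm (N \<Otimes>\<^sub>M N) ?B"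
      unfolding L2_norm_def
      by (subst (2) NN.distr_pair_swap, subst integral_distr) (auto simp: case_prod_beta' intro!: Bochner_Integration.integral_cong)
    have AE: "AE x in N. ((K ^^ Suc n) f x)\<^sup>2 \<le> (op_norm ^ n)\<^sup>2 * (L2_norm N (\<lambda>y. ?B (x, y)))\<^sup>2"
      using L2_pair_sections(1)[OF sf sf B'] AE_space
    proof eventually_elim
      case (elim x)
      have "\<bar>(1 / op_norm) ^ n * (K ^^ Suc n) f x\<bar> \<le> L2_norm N (\<lambda>y. ?B (x, y)) * 1"
        using L2_Cauchy_Schwarz[of "\<lambda>y. ?B (x, y)", OF _ f(1)] elim
        unfolding kernel_power_apply[OF f(1) elim(2), symmetric] L2_inner_def f(2) by simp
      then have "\<bar>(K ^^ Suc n) f x\<bar> \<le> op_norm ^ n * L2_norm N (\<lambda>y. ?B (x, y))"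
        using pos by (simp add: abs_mult power_one_over field_simps del: funpow.simps)
      then have "\<bar>(K ^^ Suc n) f x\<bar>\<^sup>2 \<le> (op_norm ^ n * L2_norm N (\<lambda>y. ?B (x, y)))\<^sup>2"
        by (intro power_mono) auto
      then show ?case
        by (simp only: power2_abs power_mult_distrib)
    qed
    have i: "integrable N (\<lambda>x. (op_norm ^ n)\<^sup>2 * (L2_norm N (\<lambda>y. ?B (x, y)))\<^sup>2)"
      using L2_pair_sections(2)[OF sf sf B'] by simp
    have "(L2_norm N ((K ^^ Suc n) f))\<^sup>2 \<le> (\<integral>x. (op_norm ^ n)\<^sup>2 * (L2_norm N (\<lambda>y. ?B (x, y)))\<^sup>2 \<partial>N)"
      unfolding L2_norm_square by (rule integral_mono_AE[OF L2_integrable_square[OF K_power_L2[OF f(1)]] i[unfolded L2_norm_square] AE[unfolded L2_norm_square]])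
    also have "\<dots> = (op_norm ^ n)\<^sup>2 * (L2_norm (N \<Otimes>\<^sub>M N) ?B)\<^sup>2"
      using L2_pair_sections(3)[OF sf sf B'] by (simp add: norm')
    finally have "(L2_norm N ((K ^^ Suc n) f))\<^sup>2 \<le> (op_norm ^ n * L2_norm (N \<Otimes>\<^sub>M N) ?B)\<^sup>2"
      by (simp only: power_mult_distrib)
    then show ?thesis
      by (rule power2_le_imp_le) (simp add: op_norm_nonneg L2_norm_nonneg)
  qed
  let ?c = "op_norm ^ n * L2_norm (N \<Otimes>\<^sub>M N) ?B"
  have c0: "0 \<le> ?c"
    by (simp add: op_norm_nonneg L2_norm_nonneg)
  \<comment> \<open>Taking roots leaves \<open>L2_norm N (K f)\<close> alone on the left, so that
    the supremum defining \<open>op_norm\<close> can be taken.\<close>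
  have "L2_norm N (K f) \<le> root (Suc n) ?c" if f: "f \<in> L2 N" "L2_norm N f \<le> 1" for f
  proof (cases "L2_norm N f = 0")
    case True
    then have "L2_norm N (K f) = 0"
      using K_norm_le[OF f(1)] L2_norm_nonneg[of N "K f"] by simp
    then show ?thesis
      using c0 by simp
  next
    case False
    let ?m = "L2_norm N f"
    have m: "0 < ?m"
      using False L2_norm_nonneg[of N f] by simp
    let ?g = "\<lambda>x. (1 / ?m) * f x"
    have g: "?g \<in> L2 N" "L2_norm N ?g = 1"
      using m by (auto simp only: L2_norm_scale intro!: L2_scale f) simp
    \<comment> \<open>Normalising divides by \<open>?m \<le> 1\<close>, which can only enlarge the
      norm.\<close>
    have "L2_norm N (K f) \<le> L2_norm N (K ?g)"
      using m f(2) L2_norm_nonneg[of N "K f"] mult_left_le[of ?m "L2_norm N (K f)"] unfolding K_scale L2_norm_scale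
      by (simp add: field_simps)
    also have "L2_norm N (K ?g) = root (Suc n) (L2_norm N (K ?g) ^ Suc n)"
      by (rule real_root_power_cancel[symmetric]) (simp_all add: L2_norm_nonneg)
    also have "\<dots> \<le> root (Suc n) ?c"
      using K_power_norm_ge[OF g, of "Suc n"] bound[OF g] by (intro real_root_le_mono) linarith+
    finally show ?thesis .
  qed
  then have "op_norm \<le> root (Suc n) ?c"
    unfolding op_norm_def using L2_zero[of N] L2_norm_zero[of N]
    by (intro cSUP_least) (auto intro!: exI[of _ "\<lambda>x. 0"])
  then have "op_norm ^ Suc n \<le> ?c"
    using power_mono[OF _ op_norm_nonneg, of "root (Suc n) ?c" "Suc n"] c0 by (simp add: real_root_pow_pos2 del: power_Suc)
  then show ?thesis
    using pos by simp
qed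

section \<open>An eigenfunction for the operator norm\<close>

lemma op_norm_eigenvalue_pos:
  assumes pos: "0 < op_norm"
  shows "graphon_eigenvalue N W op_norm"
proof -
  note sf = sigma_finite_measure_axioms
  let ?NN = "N \<Otimes>\<^sub>M N"
  let ?B = kernel_power
  let ?A = "\<lambda>a z. 1 / op_norm * lift a z"
  define s where "s n = L2_inner ?NN (?B 0) (?B n)" for n
  have s_norm: "s (2 * n) = (L2_norm ?NN (?B n))\<^sup>2" for n
    using kernel_power_inner_add[of n n] by (simp add: L2_norm_square_inner s_def mult_2)
  \<comment> \<open>Every index on the right is even, and at even indices \<open>s\<close> is a
    squared norm, hence monotone and convergent. At odd indices \<open>s\<close> is not known to be
    a squared norm; this is why only even iterates are compared.\<close>
  have dist: "(L2_norm ?NN (\<lambda>z. ?B (2 * i) z - ?B (2 * j) z))\<^sup>2 = s (4 * i) - 2 * s (2 * (i + j)) + s (4 * j)" for i j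
    using s_norm[of "2 * i"] s_norm[of "2 * j"] kernel_power_inner_add[of "2 * i" "2 * j"]
    by (simp add: L2_norm_diff_square[OF kernel_power_L2 kernel_power_L2] s_def algebra_simps)
  have "decseq (\<lambda>n. s (2 * n))"
    unfolding s_norm by (intro decseq_SucI power_mono kernel_power_norm_decreasing pos L2_norm_nonneg)
  moreover have "\<forall>n. 0 \<le> s (2 * n)"
    by (simp add: s_norm)
  ultimately obtain l where l: "(\<lambda>n. s (2 * n)) \<longlonglongrightarrow> l"
    using decseq_convergent by blast
  have cauchy: "\<exists>M. \<forall>i\<ge>M. \<forall>j\<ge>M. L2_norm ?NN (\<lambda>z. ?B (2 * i) z - ?B (2 * j) z) \<le> e" if e: "0 < e" for e
  proof -
    have "0 < e\<^sup>2 / 4"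
      using e by simp
    \<comment> \<open>The three values of \<open>s\<close> in \<open>dist\<close> have weights 1, 2
      and 1, so errors below a quarter of e^2 add up to less than e^2.\<close>
    then obtain M where M: "\<And>n. n \<ge> M \<Longrightarrow> \<bar>s (2 * n) - l\<bar> < e\<^sup>2 / 4"
      using l unfolding LIMSEQ_iff real_norm_def by blast
    have "L2_norm ?NN (\<lambda>z. ?B (2 * i) z - ?B (2 * j) z) \<le> e" if "i \<ge> M" "j \<ge> M" for i j
    proof (rule power2_le_imp_le)
      show "(L2_norm ?NN (\<lambda>z. ?B (2 * i) z - ?B (2 * j) z))\<^sup>2 \<le> e\<^sup>2"
      proof -
        have "\<bar>s (4 * i) - l\<bar> < e\<^sup>2 / 4" "\<bar>s (4 * j) - l\<bar> < e\<^sup>2 / 4" "\<bar>s (2 * (i + j)) - l\<bar> < e\<^sup>2 / 4"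
          using M[of "2 * i"] M[of "i + j"] M[of "2 * j"] that by simp_all
        then show ?thesis
          unfolding dist by linarith
      qed
    qed (use e in simp)
    then show ?thesis
      by blast
  qed
  \<comment> \<open>A subsequence with steps of size at most (1/2)^k meets the hypothesis of the
    geometric completeness lemma.\<close>
  have "\<exists>r. \<forall>k. (\<forall>i\<ge>r k. \<forall>j\<ge>r k. L2_norm ?NN (\<lambda>z. ?B (2 * i) z - ?B (2 * j) z) \<le> (1 / 2) ^ k) \<and> r k < r (Suc k)"
  proof (rule dependent_nat_choice)
    show "\<exists>M. \<forall>i\<ge>M. \<forall>j\<ge>M. L2_norm ?NN (\<lambda>z. ?B (2 * i) z - ?B (2 * j) z) \<le> (1 / 2) ^ 0"
      by (rule cauchy) simp
    fix M n
    obtain M' where M': "\<forall>i\<ge>M'. \<forall>j\<ge>M'. L2_norm ?NN (\<lambda>z. ?B (2 * i) z - ?B (2 * j) z) \<le> (1 / 2) ^ Suc n"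
      using cauchy[of "(1 / 2) ^ Suc n"] by auto
    show "\<exists>M'. (\<forall>i\<ge>M'. \<forall>j\<ge>M'. L2_norm ?NN (\<lambda>z. ?B (2 * i) z - ?B (2 * j) z) \<le> (1 / 2) ^ Suc n) \<and> M < M'"
      by (rule exI[of _ "max M' (Suc M)"]) (use M' in auto)
  qed
  then obtain r where r: "\<And>k i j. r k \<le> i \<Longrightarrow> r k \<le> j \<Longrightarrow> L2_norm ?NN (\<lambda>z. ?B (2 * i) z - ?B (2 * j) z) \<le> (1 / 2) ^ k"
    and r_mono: "\<And>k. r k < r (Suc k)"
    by blast
  define g where "g k = ?B (2 * r k)" for k
  have g: "g k \<in> L2 ?NN" for k
    by (simp add: g_def kernel_power_L2)
  have fin: "finite_measure ?NN"
    by (rule NN.P.finite_measure_axioms)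
  have g_step: "L2_norm ?NN (\<lambda>z. g (Suc k) z - g k z) \<le> 1 * (1 / 2) ^ k" for k
    unfolding g_def using r[of k "r (Suc k)" "r k"] r_mono[of k] by simp
  note compl = finite_measure.L2_complete_geometric[OF fin, of g 1 "1 / 2", OF g g_step, simplified]
  \<comment> \<open>Taking absolute values costs nothing since the kernels are nonnegative.\<close>
  define Q where "Q z = \<bar>lim (\<lambda>n. g n z)\<bar>" for z
  have Q: "Q \<in> L2 ?NN"
    unfolding Q_def by (intro L2_abs compl)
  have gQ: "L2_norm ?NN (\<lambda>z. g k z - Q z) \<le> 2 * (1 / 2) ^ k" for k
  proof -
    have "(\<integral>z. (g k z - Q z)\<^sup>2 \<partial>?NN) \<le> (\<integral>z. (g k z - lim (\<lambda>n. g n z))\<^sup>2 \<partial>?NN)"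
    proof (intro integral_mono L2_integrable_square L2_diff g Q compl(2))
      fix z assume "z \<in> space ?NN"
      then have "0 \<le> g k z"
        by (auto simp: g_def space_pair_measure kernel_power_nonneg)
      then show "(g k z - Q z)\<^sup>2 \<le> (g k z - lim (\<lambda>n. g n z))\<^sup>2"
        unfolding Q_def abs_le_square_iff[symmetric] by linarith
    qed
    then have "L2_norm ?NN (\<lambda>z. g k z - Q z) \<le> L2_norm ?NN (\<lambda>z. g k z - lim (\<lambda>n. g n z))"
      by (simp add: L2_norm_def)
    also have "\<dots> \<le> 2 * (1 / 2) ^ k"
      using compl(3)[of k] by simp
    finally show ?thesis .
  qed
  have AL2: "?A a \<in> L2 ?NN" if "a \<in> L2 ?NN" for a
    using that by (intro L2_scale lift_L2 sf)
  have zero_le: "x \<le> 0" if "\<And>k. x \<le> c * (1 / 2) ^ k" for x c :: real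
  proof -
    have "(\<lambda>k. c * (1 / 2) ^ k) \<longlonglongrightarrow> c * 0"
      by (intro tendsto_intros LIMSEQ_power_zero) auto
    then show ?thesis
      using that by (intro LIMSEQ_le_const[of "\<lambda>k. c * (1 / 2) ^ k"]) auto
  qed
  \<comment> \<open>5 = 2 + 2 + 1. Two terms compare Q with \<open>g k\<close>, the first of them
    after applying A^2, which does not expand distances. The third compares \<open>g k\<close> with
    its image under A^2, which is the next even iterate and so is covered by the choice of
    \<open>r\<close>.\<close>
  have "L2_norm ?NN (\<lambda>z. ?A (?A Q) z - Q z) \<le> 5 * (1 / 2) ^ k" for k
  proof -
    have "L2_norm ?NN (\<lambda>z. ?A (?A Q) z - Q z)
        \<le> L2_norm ?NN (\<lambda>z. ?A (?A Q) z - ?A (?A (g k)) z) + L2_norm ?NN (\<lambda>z. ?A (?A (g k)) z - Q z)"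
      by (intro L2_norm_triangle_diff AL2 Q g)
    also have "L2_norm ?NN (\<lambda>z. ?A (?A (g k)) z - Q z)
        \<le> L2_norm ?NN (\<lambda>z. ?A (?A (g k)) z - g k z) + L2_norm ?NN (\<lambda>z. g k z - Q z)"
      by (intro L2_norm_triangle_diff AL2 Q g)
    also have "L2_norm ?NN (\<lambda>z. ?A (?A Q) z - ?A (?A (g k)) z) \<le> L2_norm ?NN (\<lambda>z. ?A Q z - ?A (g k) z)"
      by (intro scaled_lift_diff_norm pos AL2 Q g)
    also have "\<dots> \<le> L2_norm ?NN (\<lambda>z. Q z - g k z)"
      by (intro scaled_lift_diff_norm pos Q g)
    also have "\<dots> = L2_norm ?NN (\<lambda>z. g k z - Q z)"
      by (rule L2_norm_minus_commute)
    also have "?A (?A (g k)) = ?B (2 * Suc (r k))"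
      by (simp add: g_def)
    also have "L2_norm ?NN (\<lambda>z. ?B (2 * Suc (r k)) z - g k z) \<le> (1 / 2) ^ k"
      unfolding g_def by (rule r) auto
    finally show ?thesis
      using gQ[of k] by simp
  qed
  then have "L2_norm ?NN (\<lambda>z. ?A (?A Q) z - Q z) = 0"
    using zero_le[of _ 5] L2_norm_nonneg by (metis order_antisym)
  then have "(\<integral>y. (L2_norm N (\<lambda>x. ?A (?A Q) (x, y) - Q (x, y)))\<^sup>2 \<partial>N) = 0"
    unfolding L2_pair_sections(3)[OF sf sf L2_diff[OF AL2[OF AL2[OF Q]] Q], symmetric] by simp
  then have "AE y in N. (L2_norm N (\<lambda>x. ?A (?A Q) (x, y) - Q (x, y)))\<^sup>2 = 0"
    by (subst (asm) integral_nonneg_eq_0_iff_AE[OF L2_pair_sections(2)[OF sf sf L2_diff[OF AL2[OF AL2[OF Q]] Q]]]) auto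
  then have fix_AE: "AE y in N. L2_norm N (\<lambda>x. ?A (?A Q) (x, y) - Q (x, y)) = 0"
    by simp
  have Q_pos: "0 < L2_norm ?NN Q"
  proof (rule ccontr)
    assume "\<not> 0 < L2_norm ?NN Q"
    then have Q0: "L2_norm ?NN Q = 0"
      using L2_norm_nonneg[of ?NN Q] by simp
    have "op_norm \<le> 2 * (1 / 2) ^ k" for k
      using L2_norm_le_diff[OF g[of k] Q] gQ[of k] kernel_power_norm_ge[OF pos, of "2 * r k"] Q0 by (simp add: g_def)
    then show False
      using zero_le pos by force
  qed
  have "\<not> (AE y in N. L2_norm N (\<lambda>x. Q (x, y)) = 0)"
  proof
    assume "AE y in N. L2_norm N (\<lambda>x. Q (x, y)) = 0"
    then have "(\<integral>y. (L2_norm N (\<lambda>x. Q (x, y)))\<^sup>2 \<partial>N) = 0"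
      by (intro integral_eq_zero_AE) auto
    then show False
      using Q_pos L2_pair_sections(3)[OF sf sf Q] by simp
  qed
  \<comment> \<open>Two properties hold for almost every y, and vanishing of the section of Q does
    not, so some y satisfies all three conditions.\<close>
  with fix_AE L2_pair_sections(1)[OF sf sf Q]
  obtain y where y: "L2_norm N (\<lambda>x. ?A (?A Q) (x, y) - Q (x, y)) = 0" "(\<lambda>x. Q (x, y)) \<in> L2 N"
    "L2_norm N (\<lambda>x. Q (x, y)) \<noteq> 0"
    by (smt (verit, best) AE_mp AE_I2)
  define f where "f x = Q (x, y)" for x
  let ?T = "\<lambda>f x. 1 / op_norm * K f x"
  have f: "f \<in> L2 N" "L2_norm N f \<noteq> 0" "\<And>x. 0 \<le> f x"
    using y by (simp_all add: f_def[abs_def] Q_def)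
  have TL2: "?T h \<in> L2 N" if "h \<in> L2 N" for h
    using that by (intro L2_scale K_L2)
  have "L2_norm N (\<lambda>x. ?T (?T f) x - f x) = 0"
    using y(1) by (simp add: f_def[abs_def] lift_def)
  then have fixf: "AE x in N. ?T (?T f) x = f x"
    using L2_norm_eq_0_iff[OF L2_diff[OF TL2[OF TL2[OF f(1)]] f(1)]] by simp
  \<comment> \<open>T (T f) = f gives T h = h, so any component of f for the eigenvalue -op_norm is
    removed. T f and f are both nonnegative and cannot cancel, so h is nonzero.\<close>
  define h where "h x = ?T f x + f x" for x
  have h: "h \<in> L2 N"
    unfolding h_def by (intro L2_add TL2 f)
  have "AE x in N. K h x = op_norm * h x"
    using fixf AE_space
  proof eventually_elim
    case (elim x)
    have "K h x = op_norm * ?T (?T f) x + op_norm * ?T f x"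
      using pos K_add[OF elim(2) TL2[OF f(1)] f(1)] by (simp add: h_def[abs_def])
    then show ?case
      by (simp only: elim(1) h_def distrib_left add.commute)
  qed
  moreover have "\<not> (AE x in N. h x = 0)"
  proof
    assume "AE x in N. h x = 0"
    then have "AE x in N. f x = 0"
      using AE_space
    proof eventually_elim
      case (elim x)
      have "0 \<le> K f x"
        using elim f(3) by (auto simp: graphon_op_def W_nonneg intro!: integral_nonneg_AE AE_I2)
      then have "0 \<le> ?T f x"
        using pos by simp
      then show ?case
        using elim(1) f(3)[of x] by (simp add: h_def)
    qed
    then show False
      using f L2_norm_eq_0_iff by blast
  qed
  ultimately show ?thesis
    unfolding graphon_eigenvalue_def using h by (auto simp: L2_def)
qed

text \<open>Eigenvalues never exceed the operator norm, but \<open>GREATEST\<close> denotes this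
  bound only if it is attained, so an eigenfunction has to be exhibited.\<close>

theorem lambda_1_eq_op_norm: "lambda_1 N W = op_norm"
  unfolding lambda_1_def
proof (rule Greatest_equality)
  show "graphon_eigenvalue N W op_norm"
  proof (cases "op_norm = 0")
    case False
    then show ?thesis
      using op_norm_nonneg op_norm_eigenvalue_pos by simp
  next
    case True
    \<comment> \<open>With norm 0, \<open>K\<close> sends every square-integrable function to 0
      almost everywhere, and the constant 1 is an eigenfunction for the eigenvalue 0.\<close>
    have one: "(\<lambda>x. 1) \<in> L2 N"
      by (simp add: L2_def)
    have "L2_norm N (K (\<lambda>x. 1)) = 0"
      using K_op_norm[OF one] L2_norm_nonneg[of N "K (\<lambda>x. 1)"] True by simp
    then have "AE x in N. K (\<lambda>x. 1) x = 0"
      using L2_norm_eq_0_iff[OF K_L2[OF one]] by simp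
    then show ?thesis
      unfolding graphon_eigenvalue_def True
      by (intro bexI[of _ "\<lambda>x. 1"]) (auto simp: AE_False prob_space)
  qed
next
  fix l assume "graphon_eigenvalue N W l"
  then obtain f where f: "f \<in> L2 N" "\<not> (AE x in N. f x = 0)" "AE x in N. K f x = l * f x"
    by (auto simp: graphon_eigenvalue_def L2_def)
  have "L2_norm N (K f) = L2_norm N (\<lambda>x. l * f x)"
    using f L2_measurable[OF K_L2[OF f(1)]] L2_measurable[OF L2_scale[OF f(1)]] by (intro L2_norm_cong_AE) auto
  then have "\<bar>l\<bar> * L2_norm N f \<le> op_norm * L2_norm N f"
    using K_op_norm[OF f(1)] by (simp add: L2_norm_scale)
  moreover have "0 < L2_norm N f"
    using f L2_norm_eq_0_iff[OF f(1)] L2_norm_nonneg[of N f] by (simp add: less_le)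
  ultimately show "l \<le> op_norm"
    by simp
qed

lemma lambda_1_nonneg: "0 \<le> lambda_1 N W" and lambda_1_le_1: "lambda_1 N W \<le> 1"
  by (simp_all add: lambda_1_eq_op_norm op_norm_nonneg op_norm_le_1)

end

section \<open>Progressively measurable processes\<close>

text \<open>
  Integration over the index preserves measurability with respect to a sub-\<open>\<sigma>\<close>-algebra \<open>G\<close> up to
  null sets even if the \<open>G\<close>-measurable versions of the sections are not jointly measurable:
  test functions can be replaced by their conditional expectations given \<open>G\<close>.
\<close>

lemma integral_sections_AE_measurable:
  fixes A :: "'b \<times> 'a \<Rightarrow> real" and w :: "'b \<Rightarrow> real"
  assumes N: "sigma_finite_measure N" and MG: "finite_measure M" "subalgebra M G"
    and A: "integrable (N \<Otimes>\<^sub>M M) A"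
    and w[measurable]: "w \<in> borel_measurable N" and w_le: "\<And>y. y \<in> space N \<Longrightarrow> \<bar>w y\<bar> \<le> 1"
    and A_section: "\<And>y. y \<in> space N \<Longrightarrow> integrable M (\<lambda>m. A (y, m))"
    and A_G: "\<And>y. y \<in> space N \<Longrightarrow> \<exists>p \<in> borel_measurable G. AE m in M. A (y, m) = p m"
  shows "\<exists>p \<in> borel_measurable G. AE m in M. (\<integral>y. w y * A (y, m) \<partial>N) = p m"
proof -
  interpret finite_measure_subalgebra M G
    using MG by (simp add: finite_measure_subalgebra_def finite_measure_subalgebra_axioms_def)
  interpret N: sigma_finite_measure N by fact
  interpret pair_sigma_finite N M ..
  note [measurable] = borel_measurable_integrable[OF A]
  have M_G: "f \<in> borel_measurable M" if "f \<in> borel_measurable G" for f :: "'a \<Rightarrow> real"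
    using measurable_from_subalg[OF subalg that] .
  define z where "z m = (\<integral>y. w y * A (y, m) \<partial>N)" for m
  have z[measurable]: "z \<in> borel_measurable M"
    unfolding z_def by measurable
  have wA: "integrable (N \<Otimes>\<^sub>M M) (\<lambda>(y, m). w y * A (y, m) * \<phi> m)"
    if \<phi>: "\<phi> \<in> borel_measurable M" "\<And>m. \<bar>\<phi> m\<bar> \<le> 1" for \<phi>
  proof (rule Bochner_Integration.integrable_bound[OF A])
    note [measurable] = \<phi>(1)
    show "(\<lambda>(y, m). w y * A (y, m) * \<phi> m) \<in> borel_measurable (N \<Otimes>\<^sub>M M)"
      by measurable
    have "\<bar>w y\<bar> * \<bar>A (y, m)\<bar> * \<bar>\<phi> m\<bar> \<le> 1 * \<bar>A (y, m)\<bar> * 1" if "y \<in> space N" for y m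
      using that \<phi>(2) w_le by (intro mult_mono) auto
    then show "AE x in N \<Otimes>\<^sub>M M. norm (case x of (y, m) \<Rightarrow> w y * A (y, m) * \<phi> m) \<le> norm (A x)"
      by (intro AE_I2) (auto simp: space_pair_measure abs_mult)
  qed
  have int_z: "integrable M z"
    using integrable_snd[OF wA[of "\<lambda>m. 1"]] by (simp add: z_def[abs_def])
  have swap: "(\<integral>m. z m * \<phi> m \<partial>M) = (\<integral>y. w y * (\<integral>m. A (y, m) * \<phi> m \<partial>M) \<partial>N)"
    if \<phi>: "\<phi> \<in> borel_measurable M" "\<And>m. \<bar>\<phi> m\<bar> \<le> 1" for \<phi>
  proof -
    have "(\<integral>m. z m * \<phi> m \<partial>M) = (\<integral>m. (\<integral>y. w y * A (y, m) * \<phi> m \<partial>N) \<partial>M)"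
      by (simp add: z_def)
    also have "\<dots> = (\<integral>y. (\<integral>m. w y * A (y, m) * \<phi> m \<partial>M) \<partial>N)"
      by (rule Fubini_integral[OF wA[OF \<phi>]])
    finally show ?thesis
      by (simp add: mult.assoc)
  qed
  let ?C = "real_cond_exp M G"
  \<comment> \<open>\<open>z\<close> and its conditional expectation have the same integral against
    every bounded test function: \<phi> is replaced by its conditional expectation inside each
    section, and the expectation is then moved over to \<open>z\<close>.\<close>
  have test: "(\<integral>m. z m * \<phi> m \<partial>M) = (\<integral>m. ?C z m * \<phi> m \<partial>M)"
    if \<phi>[measurable]: "\<phi> \<in> borel_measurable M" and \<phi>_le: "\<And>m. \<bar>\<phi> m\<bar> \<le> 1" for \<phi>
  proof -
    have int_\<phi>: "integrable M \<phi>"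
      using \<phi>_le by (intro Bochner_Integration.integrable_bound[OF integrable_const[of "1 :: real"]]) auto
    have C_ge: "AE m in M. -1 \<le> ?C \<phi> m"
      by (rule real_cond_exp_ge_c[OF int_\<phi>]) (use \<phi>_le in \<open>auto simp: abs_le_iff minus_le_iff\<close>)
    have C_le: "AE m in M. ?C \<phi> m \<le> 1"
      by (rule real_cond_exp_le_c[OF int_\<phi>]) (use \<phi>_le in \<open>auto simp: abs_le_iff\<close>)
    \<comment> \<open>The conditional expectation of \<phi> lies in [-1,1] only almost everywhere;
      its truncation does so everywhere, as \<open>swap\<close> demands.\<close>
    define \<psi> where "\<psi> m = max (-1) (min 1 (?C \<phi> m))" for m
    have \<psi>[measurable]: "\<psi> \<in> borel_measurable M" and \<psi>_le: "\<bar>\<psi> m\<bar> \<le> 1" for m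
      by (auto simp: \<psi>_def[abs_def])
    have \<psi>_C: "AE m in M. \<psi> m = ?C \<phi> m"
      using C_ge C_le by eventually_elim (simp add: \<psi>_def)
    \<comment> \<open>The version p may depend on y in any way whatsoever: only the two integrals,
      which do not mention p, are carried on.\<close>
    have "(\<integral>m. A (y, m) * \<phi> m \<partial>M) = (\<integral>m. A (y, m) * \<psi> m \<partial>M)" if y: "y \<in> space N" for y
    proof -
      obtain p where p: "p \<in> borel_measurable G" "AE m in M. A (y, m) = p m"
        using A_G[OF y] by blast
      note [measurable] = M_G[OF p(1)] borel_measurable_integrable[OF A_section[OF y]]
      have "integrable M (\<lambda>m. A (y, m) * \<phi> m)"
        using \<phi>_le by (intro Bochner_Integration.integrable_bound[OF A_section[OF y]]) (auto simp: abs_mult mult_left_le)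
      moreover have p\<phi>: "AE m in M. A (y, m) * \<phi> m = p m * \<phi> m"
        using p(2) by auto
      ultimately have int: "integrable M (\<lambda>m. p m * \<phi> m)"
        by (subst integrable_cong_AE[symmetric]) auto
      have "(\<integral>m. A (y, m) * \<phi> m \<partial>M) = (\<integral>m. p m * \<phi> m \<partial>M)"
        using p\<phi> by (intro integral_cong_AE) auto
      also have "\<dots> = (\<integral>m. p m * ?C \<phi> m \<partial>M)"
        by (rule real_cond_exp_intg(2)[symmetric, OF int p(1) \<phi>])
      also have "\<dots> = (\<integral>m. A (y, m) * \<psi> m \<partial>M)"
        using p(2) \<psi>_C by (intro integral_cong_AE) auto
      finally show ?thesis .
    qed
    then have "(\<integral>m. z m * \<phi> m \<partial>M) = (\<integral>m. z m * \<psi> m \<partial>M)"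
      unfolding swap[OF \<phi> \<phi>_le] swap[OF \<psi> \<psi>_le] by (intro Bochner_Integration.integral_cong) auto
    also have "\<dots> = (\<integral>m. ?C \<phi> m * z m \<partial>M)"
      using \<psi>_C by (intro integral_cong_AE) auto
    also have "\<dots> = (\<integral>m. ?C \<phi> m * ?C z m \<partial>M)"
    proof (rule real_cond_exp_intg(2)[symmetric])
      have "integrable M (\<lambda>m. \<psi> m * z m)"
        using \<psi>_le by (intro Bochner_Integration.integrable_bound[OF int_z]) (auto simp: abs_mult mult_left_le_one_le)
      moreover have "AE m in M. \<psi> m * z m = ?C \<phi> m * z m"
        using \<psi>_C by auto
      ultimately show "integrable M (\<lambda>m. ?C \<phi> m * z m)"
        by (subst integrable_cong_AE[symmetric]) auto
    qed auto
    also have "\<dots> = (\<integral>m. ?C z m * ?C \<phi> m \<partial>M)"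
      by (simp add: mult.commute)
    also have "\<dots> = (\<integral>m. ?C z m * \<phi> m \<partial>M)"
    proof (rule real_cond_exp_intg(2))
      show "integrable M (\<lambda>m. ?C z m * \<phi> m)"
        using \<phi>_le by (intro Bochner_Integration.integrable_bound[OF real_cond_exp_int(1)[OF int_z]]) (auto simp: abs_mult mult_left_le)
    qed auto
    finally show ?thesis .
  qed
  \<comment> \<open>Testing with the sign of the difference turns equality of integrals into
    vanishing L1 distance.\<close>
  define \<phi> where "\<phi> m = sgn (z m - ?C z m)" for m
  have \<phi>: "\<phi> \<in> borel_measurable M" "\<And>m. \<bar>\<phi> m\<bar> \<le> 1"
    by (auto simp: \<phi>_def[abs_def] sgn_if)
  have int_C: "integrable M (?C z)"
    using int_z by (rule real_cond_exp_int)
  have "integrable M (\<lambda>m. f m * \<phi> m)" if "integrable M f" for f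
    using \<phi> that by (intro Bochner_Integration.integrable_bound[OF that]) (auto simp: abs_mult mult_left_le)
  note this[OF int_z] this[OF int_C]
  then have "(\<integral>m. (z m - ?C z m) * \<phi> m \<partial>M) = 0"
    using test[OF \<phi>] by (simp add: left_diff_distrib)
  then have "(\<integral>m. \<bar>z m - ?C z m\<bar> \<partial>M) = 0"
    by (simp add: \<phi>_def linordered_idom_class.mult_sgn_abs abs_sgn)
  then have "AE m in M. \<bar>z m - ?C z m\<bar> = 0"
    using int_z int_C by (subst (asm) integral_nonneg_eq_0_iff_AE) auto
  then show ?thesis
    unfolding z_def[symmetric] by (intro bexI[of _ "?C z"]) auto
qed

locale process_space = P: prob_space P for P :: "'w measure" +
  fixes T :: real and F :: "real \<Rightarrow> 'w measure"
  assumes T_pos: "0 < T"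
    and F_subalgebra: "\<And>t. t \<in> {0..T} \<Longrightarrow> subalgebra P (F t)"
begin

abbreviation M :: "(real \<times> 'w) measure" where
  "M \<equiv> time_measure T \<Otimes>\<^sub>M P"

lemma space_time: "space (time_measure T) = {0..T}"
  by (simp add: time_measure_def space_restrict_space)

lemma sets_time: "sets (time_measure T) = sets (restrict_space borel {0..T})"
  by (simp add: time_measure_def sets_restrict_space)

lemma space_M: "space M = {0..T} \<times> space P"
  by (simp add: space_pair_measure space_time)

lemma finite_measure_time: "finite_measure (time_measure T)"
proof
  show "emeasure (time_measure T) (space (time_measure T)) \<noteq> \<infinity>"
    unfolding space_time using T_pos by (simp add: time_measure_def emeasure_restrict_space)
qed

sublocale time: finite_measure "time_measure T"
  by (rule finite_measure_time)

sublocale pair: pair_sigma_finite "time_measure T" P ..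

lemma finite_measure_M: "finite_measure M"
proof
  show "emeasure M (space M) \<noteq> \<infinity>"
    by (simp add: space_pair_measure P.emeasure_pair_measure_Times ennreal_mult_eq_top_iff)
qed

sublocale M: finite_measure M
  by (rule finite_measure_M)

section \<open>The progressive sigma-algebra\<close>

definition progressive_sets :: "(real \<times> 'w) set set" where
  "progressive_sets = {A. A \<subseteq> {0..T} \<times> space P \<and>
     (\<forall>t \<in> {0..T}. A \<inter> ({0..t} \<times> space P) \<in> sets (restrict_space borel {0..t} \<Otimes>\<^sub>M F t))}"

definition progressive_algebra :: "(real \<times> 'w) measure" where
  "progressive_algebra = sigma ({0..T} \<times> space P) progressive_sets"

lemma space_F: "t \<in> {0..T} \<Longrightarrow> space (F t) = space P"
  using F_subalgebra by (simp add: subalgebra_def)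

lemma space_until: "t \<in> {0..T} \<Longrightarrow> space (restrict_space borel {0..t} \<Otimes>\<^sub>M F t) = {0..t} \<times> space P"
  by (simp add: space_pair_measure space_restrict_space space_F)

lemma sigma_algebra_progressive_sets: "sigma_algebra ({0..T} \<times> space P) progressive_sets"
  unfolding sigma_algebra_iff2
proof (intro conjI allI impI ballI)
  show "progressive_sets \<subseteq> Pow ({0..T} \<times> space P)" "{} \<in> progressive_sets"
    by (auto simp: progressive_sets_def)
next
  fix A assume A: "A \<in> progressive_sets"
  have "({0..T} \<times> space P - A) \<inter> ({0..t} \<times> space P) \<in> sets (restrict_space borel {0..t} \<Otimes>\<^sub>M F t)"
    if t: "t \<in> {0..T}" for t
  proof -
    have "({0..T} \<times> space P - A) \<inter> ({0..t} \<times> space P)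
        = space (restrict_space borel {0..t} \<Otimes>\<^sub>M F t) - A \<inter> ({0..t} \<times> space P)"
      using t by (auto simp: space_until)
    then show ?thesis
      using A t by (auto simp: progressive_sets_def)
  qed
  then show "{0..T} \<times> space P - A \<in> progressive_sets"
    by (auto simp: progressive_sets_def)
next
  fix A :: "nat \<Rightarrow> (real \<times> 'w) set" assume A: "range A \<subseteq> progressive_sets"
  have "(\<Union>i. A i) \<inter> ({0..t} \<times> space P) \<in> sets (restrict_space borel {0..t} \<Otimes>\<^sub>M F t)"
    if t: "t \<in> {0..T}" for t
  proof -
    have "(\<Union>i. A i) \<inter> ({0..t} \<times> space P) = (\<Union>i. A i \<inter> ({0..t} \<times> space P))"
      by auto
    also have "\<dots> \<in> sets (restrict_space borel {0..t} \<Otimes>\<^sub>M F t)"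
      using A t by (intro sets.countable_UN) (auto simp: progressive_sets_def)
    finally show ?thesis .
  qed
  then show "(\<Union>i. A i) \<in> progressive_sets"
    using A by (auto simp: progressive_sets_def)
qed

lemma sets_progressive_algebra: "sets progressive_algebra = progressive_sets"
  unfolding progressive_algebra_def
  using sigma_algebra.sets_measure_of_eq[OF sigma_algebra_progressive_sets] by simp

lemma space_progressive_algebra: "space progressive_algebra = {0..T} \<times> space P"
  unfolding progressive_algebra_def by (simp add: space_measure_of_conv)

text \<open>With progressivity expressed by a single sigma-algebra, sums, pointwise limits and
  conditional expectations can be used without treating each time separately.\<close>

lemma progressive_iff: "progressive T F p \<longleftrightarrow> case_prod p \<in> borel_measurable progressive_algebra"
proof -
  have eq: "(case_prod p -` B \<inter> ({0..T} \<times> space P)) \<inter> ({0..t} \<times> space P) = case_prod p -` B \<inter> ({0..t} \<times> space P)"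
    if "t \<in> {0..T}" for B :: "real set" and t
    using that by auto
  have "case_prod p \<in> borel_measurable progressive_algebra \<longleftrightarrow>
      (\<forall>B \<in> sets borel. \<forall>t \<in> {0..T}. case_prod p -` B \<inter> ({0..t} \<times> space P) \<in> sets (restrict_space borel {0..t} \<Otimes>\<^sub>M F t))"
    by (auto simp: measurable_def sets_progressive_algebra space_progressive_algebra progressive_sets_def eq)
  also have "\<dots> \<longleftrightarrow> progressive T F p"
    unfolding progressive_def measurable_def by (auto simp: space_until)
  finally show ?thesis ..
qed

text \<open>The defining condition at t = T suffices, because every event of \<open>F T\<close> is
  an event of \<open>P\<close>.\<close>

lemma subalgebra_progressive: "subalgebra M progressive_algebra"
  unfolding subalgebra_def
proof
  show "space progressive_algebra = space M"
    by (simp add: space_progressive_algebra space_M)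
  show "sets progressive_algebra \<subseteq> sets M"
  proof
    fix A assume "A \<in> sets progressive_algebra"
    then have A: "A \<subseteq> {0..T} \<times> space P" "A \<inter> ({0..T} \<times> space P) \<in> sets (restrict_space borel {0..T} \<Otimes>\<^sub>M F T)"
      using T_pos by (auto simp: sets_progressive_algebra progressive_sets_def)
    have "snd \<in> M \<rightarrow>\<^sub>M F T"
      using measurable_snd[of "time_measure T" P] F_subalgebra[of T] T_pos
      by (auto simp: measurable_def subalgebra_def)
    moreover have "fst \<in> M \<rightarrow>\<^sub>M restrict_space borel {0..T}"
      using measurable_fst[of "time_measure T" P] by (simp add: measurable_cong_sets[OF refl sets_time])
    ultimately have "(\<lambda>z. (fst z, snd z)) \<in> M \<rightarrow>\<^sub>M restrict_space borel {0..T} \<Otimes>\<^sub>M F T"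
      by (rule measurable_Pair[rotated])
    then have "(\<lambda>z. (fst z, snd z)) -` A \<inter> space M \<in> sets M"
      by (rule measurable_sets) (use A in \<open>simp add: Int_absorb2\<close>)
    then show "A \<in> sets M"
      using A by (simp add: space_M Int_absorb2)
  qed
qed

section \<open>Actions as square-integrable functions of time and scenario\<close>

lemma nn_integral_process:
  assumes "case_prod a \<in> borel_measurable M"
  shows "(\<integral>\<^sup>+t. (\<integral>\<^sup>+w. ennreal ((a t w)\<^sup>2) \<partial>P) \<partial>time_measure T) = (\<integral>\<^sup>+z. ennreal ((case_prod a z)\<^sup>2) \<partial>M)"
  by (subst P.nn_integral_fst[symmetric]) (use assms in auto)

lemma actions_iff:
  "a \<in> actions P T F \<longleftrightarrow>
    case_prod a \<in> L2 M \<and> (\<exists>p \<in> borel_measurable progressive_algebra. AE z in M. case_prod a z = p z)"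
proof -
  have "(\<exists>p. progressive T F p \<and> same_process P T a p) \<longleftrightarrow>
      (\<exists>p \<in> borel_measurable progressive_algebra. AE z in M. case_prod a z = p z)"
  proof safe
    fix p assume "progressive T F p" "same_process P T a p"
    then show "\<exists>p \<in> borel_measurable progressive_algebra. AE z in M. case_prod a z = p z"
      by (intro bexI[of _ "case_prod p"]) (auto simp: progressive_iff same_process_def case_prod_beta')
  next
    fix p assume "p \<in> borel_measurable progressive_algebra" "AE z in M. case_prod a z = p z"
    then show "\<exists>p. progressive T F p \<and> same_process P T a p"
      by (intro exI[of _ "curry p"]) (auto simp: progressive_iff same_process_def case_prod_beta')
  qed
  then show ?thesis
    unfolding actions_def L2_iff_nn_integral by (auto simp: nn_integral_process)
qed

lemma actions_L2: "a \<in> actions P T F \<Longrightarrow> case_prod a \<in> L2 M"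
  by (simp add: actions_iff)

lemma actions_combination:
  assumes "a \<in> actions P T F" "b \<in> actions P T F"
  shows "(\<lambda>t w. c * a t w + d * b t w) \<in> actions P T F"
proof -
  obtain p q where pq[measurable]: "p \<in> borel_measurable progressive_algebra" "q \<in> borel_measurable progressive_algebra"
    and AE: "AE z in M. case_prod a z = p z" "AE z in M. case_prod b z = q z"
    using assms by (auto simp: actions_iff)
  have "case_prod (\<lambda>t w. c * a t w + d * b t w) = (\<lambda>z. c * case_prod a z + d * case_prod b z)"
    by auto
  moreover have "(\<lambda>z. c * case_prod a z + d * case_prod b z) \<in> L2 M"
    using assms by (intro L2_add L2_scale actions_L2)
  moreover have "AE z in M. c * case_prod a z + d * case_prod b z = c * p z + d * q z"
    using AE by eventually_elim simp
  ultimately show ?thesis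
    unfolding actions_iff by (auto intro!: bexI[of _ "\<lambda>z. c * p z + d * q z"])
qed

lemma actions_diff:
  assumes "a \<in> actions P T F" "b \<in> actions P T F"
  shows "(\<lambda>t w. a t w - b t w) \<in> actions P T F"
  using actions_combination[OF assms, of 1 "-1"] by simp

text \<open>The progressive versions agree with the given processes off one common null set, and
  their pointwise \<open>lim\<close> is measurable even where the sequence diverges.\<close>

lemma actions_limit:
  assumes s: "\<And>n. s n \<in> actions P T F" and a: "case_prod a \<in> L2 M"
    and lim: "AE z in M. (\<lambda>n. case_prod (s n) z) \<longlonglongrightarrow> case_prod a z"
  shows "a \<in> actions P T F"
proof -
  have "\<exists>p. \<forall>n. p n \<in> borel_measurable progressive_algebra \<and> (AE z in M. case_prod (s n) z = p n z)"
    using s by (intro choice) (auto simp: actions_iff)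
  then obtain p where p[measurable]: "\<And>n. p n \<in> borel_measurable progressive_algebra"
    and AE: "\<And>n. AE z in M. case_prod (s n) z = p n z"
    by blast
  have "AE z in M. \<forall>n. case_prod (s n) z = p n z"
    using AE by (simp add: AE_all_countable)
  with lim have "AE z in M. case_prod a z = lim (\<lambda>n. p n z)"
    by eventually_elim (simp add: limI)
  then show ?thesis
    unfolding actions_iff using a by (intro conjI bexI[of _ "\<lambda>z. lim (\<lambda>n. p n z)"]) auto
qed

lemma act_norm_eq:
  assumes "case_prod a \<in> L2 M"
  shows "act_norm P T a = L2_norm M (case_prod a)"
proof -
  have "integrable M (\<lambda>(t, w). (a t w)\<^sup>2)"
    using L2_integrable_square[OF assms] by (simp add: case_prod_beta')
  from pair.integral_fst[OF this] show ?thesis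
    by (simp add: act_norm_def L2_norm_def case_prod_beta')
qed

lemma act_inner_eq:
  assumes "case_prod a \<in> L2 M" "case_prod b \<in> L2 M"
  shows "act_inner P T a b = L2_inner M (case_prod a) (case_prod b)"
proof -
  have "integrable M (\<lambda>(t, w). a t w * b t w)"
    using L2_mult_integrable[OF assms] by (simp add: case_prod_beta')
  from pair.integral_snd[OF this] show ?thesis
    by (simp add: act_inner_def L2_inner_def case_prod_beta')
qed

lemma act_dist_eq:
  assumes "case_prod a \<in> L2 M" "case_prod b \<in> L2 M"
  shows "act_dist P T a b = L2_norm M (\<lambda>z. case_prod a z - case_prod b z)"
  using act_norm_eq[of "\<lambda>t w. a t w - b t w"] L2_diff[OF assms] by (simp add: act_dist_def case_prod_beta')

lemma act_dist_nonneg: "a \<in> actions P T F \<Longrightarrow> b \<in> actions P T F \<Longrightarrow> 0 \<le> act_dist P T a b"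
  by (simp add: act_dist_eq actions_L2 L2_norm_nonneg)

lemma act_dist_self: "a \<in> actions P T F \<Longrightarrow> act_dist P T a a = 0"
  by (simp add: act_dist_eq actions_L2 L2_norm_zero)

lemma act_dist_commute:
  assumes "a \<in> actions P T F" "b \<in> actions P T F"
  shows "act_dist P T a b = act_dist P T b a"
  unfolding act_dist_eq[OF actions_L2[OF assms(1)] actions_L2[OF assms(2)]]
    act_dist_eq[OF actions_L2[OF assms(2)] actions_L2[OF assms(1)]]
  by (rule L2_norm_minus_commute)

lemma act_dist_triangle:
  assumes "a \<in> actions P T F" "b \<in> actions P T F" "c \<in> actions P T F"
  shows "act_dist P T a c \<le> act_dist P T a b + act_dist P T b c"
  using L2_norm_triangle_diff[OF assms[THEN actions_L2]]
  unfolding act_dist_eq[OF actions_L2[OF assms(1)] actions_L2[OF assms(2)]]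
    act_dist_eq[OF actions_L2[OF assms(2)] actions_L2[OF assms(3)]]
    act_dist_eq[OF actions_L2[OF assms(1)] actions_L2[OF assms(3)]] .

lemma same_process_iff_dist:
  assumes "a \<in> actions P T F" "b \<in> actions P T F"
  shows "same_process P T a b \<longleftrightarrow> act_dist P T a b = 0"
  unfolding act_dist_eq[OF assms[THEN actions_L2]]
    L2_norm_eq_0_iff[OF L2_diff[OF assms[THEN actions_L2]]]
  by (simp add: same_process_def case_prod_beta')

section \<open>Stability of best replies\<close>

text \<open>Strong concavity is used at the point with parameter u on the segment from the maximiser
  \<open>a\<close> to \<open>b\<close>, where f is at most \<open>f a\<close>. The quadratic terms
  combine to u (1 - u) times the squared distance; dividing by u and letting u tend to 0 yields the
  full constant \<alpha>/2. This takes the place of a first-order condition.\<close>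

lemma arg_max_quadratic_growth:
  assumes conc: "strongly_concave P T F \<alpha> f"
    and C: "C \<subseteq> actions P T F" "convex_actions C"
    and max: "is_arg_max f (\<lambda>a. a \<in> C) a" and b: "b \<in> C"
  shows "\<alpha> / 2 * (act_dist P T a b)\<^sup>2 \<le> f a - f b"
proof -
  have a: "a \<in> C" and le: "\<And>c. c \<in> C \<Longrightarrow> f c \<le> f a"
    using max by (auto simp: is_arg_max_linorder)
  have a': "a \<in> actions P T F" and b': "b \<in> actions P T F"
    using a b C by auto
  let ?a = "case_prod a" and ?b = "case_prod b"
  note L2 = actions_L2[OF a'] actions_L2[OF b']
  have growth: "\<alpha> / 2 * (1 - u) * (act_dist P T a b)\<^sup>2 \<le> f a - f b" if u: "0 < u" "u \<le> 1" for u
  proof -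
    let ?c = "\<lambda>t w. (1 - u) * a t w + u * b t w"
    have c: "?c \<in> C"
      using a b u C(2) by (auto simp: convex_actions_def)
    then have c': "?c \<in> actions P T F"
      using C by auto
    have "(act_norm P T ?c)\<^sup>2 = (L2_norm M (\<lambda>z. (1 - u) * ?a z + u * ?b z))\<^sup>2"
      unfolding act_norm_eq[OF actions_L2[OF c']] by (simp add: case_prod_beta')
    also have "\<dots> = (1 - u) * (act_norm P T a)\<^sup>2 + u * (act_norm P T b)\<^sup>2 - u * (1 - u) * (act_dist P T a b)\<^sup>2"
      unfolding act_dist_eq[OF L2] act_norm_eq[OF L2(1)] act_norm_eq[OF L2(2)] L2_norm_diff_square[OF L2]
        L2_norm_add_square[OF L2_scale[OF L2(1)] L2_scale[OF L2(2)]]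
        L2_norm_scale L2_inner_scale_left L2_inner_scale_right power_mult_distrib power2_abs
      by algebra
    finally have norm: "(act_norm P T ?c)\<^sup>2 = \<dots>" .
    have "(1 - u) * (f a + \<alpha> / 2 * (act_norm P T a)\<^sup>2) + u * (f b + \<alpha> / 2 * (act_norm P T b)\<^sup>2)
        \<le> f ?c + \<alpha> / 2 * (act_norm P T ?c)\<^sup>2"
      using conc a' b' u by (auto simp: strongly_concave_def Let_def)
    also have "f ?c \<le> f a"
      by (rule le[OF c])
    finally have "u * (\<alpha> / 2 * (1 - u) * (act_dist P T a b)\<^sup>2) \<le> u * (f a - f b)"
      unfolding norm by (simp add: algebra_simps add_divide_distrib diff_divide_distrib)
    then show ?thesis
      using u by simp
  qed
  have "((\<lambda>u. \<alpha> / 2 * (1 - u) * (act_dist P T a b)\<^sup>2) \<longlongrightarrow> \<alpha> / 2 * (1 - 0) * (act_dist P T a b)\<^sup>2) (at_right 0)"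
    by (intro tendsto_intros)
  moreover have "\<forall>\<^sub>F u in at_right 0. \<alpha> / 2 * (1 - u) * (act_dist P T a b)\<^sup>2 \<le> f a - f b"
    unfolding eventually_at_right_field by (rule exI[of _ 1]) (intro conjI allI impI growth, auto)
  ultimately have "\<alpha> / 2 * (1 - 0) * (act_dist P T a b)\<^sup>2 \<le> f a - f b"
    by (intro tendsto_upperbound[OF _ _ trivial_limit_at_right_real])
  then show ?thesis
    by simp
qed

lemma has_gateaux_gradient_along_line:
  assumes grad: "\<And>c. c \<in> actions P T F \<Longrightarrow> has_gateaux_gradient P T F f (G c) c"
    and a: "a \<in> actions P T F" and h: "h \<in> actions P T F"
  shows "((\<lambda>s. f (\<lambda>t w. a t w + s * h t w)) has_real_derivative
    act_inner P T (G (\<lambda>t w. a t w + s * h t w)) h) (at s)"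
proof -
  have "(\<lambda>t w. a t w + s * h t w) \<in> actions P T F"
    using actions_combination[OF a h, of 1 s] by simp
  from grad[OF this] h show ?thesis
    by (simp add: DERIV_def has_gateaux_gradient_def distrib_right add.assoc)
qed

text \<open>The growth inequalities of the two maximisers add up: \<alpha> times the squared
  distance is at most the increment of \<open>f\<^sub>1 - f\<^sub>2\<close> from
  \<open>a\<^sub>2\<close> to \<open>a\<^sub>1\<close>. The mean value theorem for this difference
  puts both gradients at the same intermediate point, which is where \<open>close\<close> compares
  them.\<close>

lemma arg_max_stability:
  assumes \<alpha>: "0 < \<alpha>"
    and conc: "strongly_concave P T F \<alpha> f\<^sub>1" "strongly_concave P T F \<alpha> f\<^sub>2"
    and grad: "\<And>c. c \<in> actions P T F \<Longrightarrow> has_gateaux_gradient P T F f\<^sub>1 (G\<^sub>1 c) c"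
      "\<And>c. c \<in> actions P T F \<Longrightarrow> has_gateaux_gradient P T F f\<^sub>2 (G\<^sub>2 c) c"
    and close: "\<And>c. c \<in> actions P T F \<Longrightarrow> act_dist P T (G\<^sub>1 c) (G\<^sub>2 c) \<le> \<delta>"
    and C: "C \<subseteq> actions P T F" "convex_actions C"
    and max: "is_arg_max f\<^sub>1 (\<lambda>a. a \<in> C) a\<^sub>1" "is_arg_max f\<^sub>2 (\<lambda>a. a \<in> C) a\<^sub>2"
  shows "\<alpha> * act_dist P T a\<^sub>1 a\<^sub>2 \<le> \<delta>"
proof -
  have aC: "a\<^sub>1 \<in> C" "a\<^sub>2 \<in> C"
    using max by (auto simp: is_arg_max_linorder)
  then have a: "a\<^sub>1 \<in> actions P T F" "a\<^sub>2 \<in> actions P T F"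
    using C by auto
  have G: "G\<^sub>1 c \<in> actions P T F" "G\<^sub>2 c \<in> actions P T F" if "c \<in> actions P T F" for c
    using grad[OF that] by (simp_all add: has_gateaux_gradient_def)
  let ?d = "act_dist P T a\<^sub>1 a\<^sub>2"
  have d0: "0 \<le> ?d"
    by (rule act_dist_nonneg[OF a])
  define h where "h = (\<lambda>t w. a\<^sub>1 t w - a\<^sub>2 t w)"
  have h: "h \<in> actions P T F"
    unfolding h_def by (rule actions_diff[OF a])
  define c where "c s = (\<lambda>t w. a\<^sub>2 t w + s * h t w)" for s
  have c: "c s \<in> actions P T F" for s
    using actions_combination[OF a(2) h, of 1 s] by (simp add: c_def)
  have "\<exists>\<xi>. 0 < \<xi> \<and> \<xi> < 1 \<and> (f\<^sub>1 (c 1) - f\<^sub>2 (c 1)) - (f\<^sub>1 (c 0) - f\<^sub>2 (c 0))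
      = (1 - 0) * (act_inner P T (G\<^sub>1 (c \<xi>)) h - act_inner P T (G\<^sub>2 (c \<xi>)) h)"
    unfolding c_def
    by (rule MVT2) (auto intro!: DERIV_diff has_gateaux_gradient_along_line grad a h)
  then obtain \<xi> where \<xi>: "(f\<^sub>1 (c 1) - f\<^sub>2 (c 1)) - (f\<^sub>1 (c 0) - f\<^sub>2 (c 0))
      = act_inner P T (G\<^sub>1 (c \<xi>)) h - act_inner P T (G\<^sub>2 (c \<xi>)) h"
    by auto
  note G\<xi> = G[OF c[of \<xi>], THEN actions_L2]
  have "act_inner P T (G\<^sub>1 (c \<xi>)) h - act_inner P T (G\<^sub>2 (c \<xi>)) h
      = L2_inner M (\<lambda>z. case_prod (G\<^sub>1 (c \<xi>)) z - case_prod (G\<^sub>2 (c \<xi>)) z) (case_prod h)"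
    unfolding act_inner_eq[OF G\<xi>(1) actions_L2[OF h]] act_inner_eq[OF G\<xi>(2) actions_L2[OF h]]
    by (rule L2_inner_diff_left[symmetric, OF G\<xi> actions_L2[OF h]])
  also have "\<dots> \<le> L2_norm M (\<lambda>z. case_prod (G\<^sub>1 (c \<xi>)) z - case_prod (G\<^sub>2 (c \<xi>)) z) * L2_norm M (case_prod h)"
    using L2_Cauchy_Schwarz[OF L2_diff[OF G\<xi>] actions_L2[OF h]] by (rule abs_le_D1)
  also have "\<dots> = act_dist P T (G\<^sub>1 (c \<xi>)) (G\<^sub>2 (c \<xi>)) * ?d"
    unfolding act_dist_eq[OF G\<xi>] act_norm_eq[OF actions_L2[OF h], symmetric] by (simp add: act_dist_def h_def)
  also have "\<dots> \<le> \<delta> * ?d"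
    by (intro mult_right_mono close c d0)
  finally have "(f\<^sub>1 a\<^sub>1 - f\<^sub>2 a\<^sub>1) - (f\<^sub>1 a\<^sub>2 - f\<^sub>2 a\<^sub>2) \<le> \<delta> * ?d"
    using \<xi> by (simp add: c_def h_def)
  moreover have "\<alpha> / 2 * ?d\<^sup>2 \<le> f\<^sub>1 a\<^sub>1 - f\<^sub>1 a\<^sub>2"
    by (rule arg_max_quadratic_growth[OF conc(1) C max(1) aC(2)])
  moreover have "\<alpha> / 2 * ?d\<^sup>2 \<le> f\<^sub>2 a\<^sub>2 - f\<^sub>2 a\<^sub>1"
    using arg_max_quadratic_growth[OF conc(2) C max(2) aC(1)] by (simp add: act_dist_commute[OF a(2,1)])
  ultimately have le: "\<alpha> * ?d * ?d \<le> \<delta> * ?d"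
    by (simp add: power2_eq_square)
  \<comment> \<open>A factor \<open>?d\<close> has to be cancelled. When it is 0 the claim is
    \<delta> \<ge> 0, which holds since \<delta> bounds a distance.\<close>
  show ?thesis
  proof (cases "?d = 0")
    case True
    have "0 \<le> \<delta>"
      using act_dist_nonneg[OF G[OF a(1)]] close[OF a(1)] by linarith
    then show ?thesis
      using True by simp
  next
    case False
    then show ?thesis
      using le d0 by simp
  qed
qed

lemma best_reply_stability:
  assumes A1: "assumption_A1 P T F U \<alpha> l\<^sub>U l\<^sub>\<theta>"
    and C: "C \<subseteq> actions P T F" "convex_actions C"
    and z: "z\<^sub>1 \<in> actions P T F" "z\<^sub>2 \<in> actions P T F"
    and h: "h\<^sub>1 \<in> actions P T F" "h\<^sub>2 \<in> actions P T F"
    and max: "is_arg_max (\<lambda>a. U a z\<^sub>1 h\<^sub>1) (\<lambda>a. a \<in> C) a\<^sub>1" "is_arg_max (\<lambda>a. U a z\<^sub>2 h\<^sub>2) (\<lambda>a. a \<in> C) a\<^sub>2"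
  shows "\<alpha> * act_dist P T a\<^sub>1 a\<^sub>2 \<le> l\<^sub>U * act_dist P T z\<^sub>1 z\<^sub>2 + l\<^sub>\<theta> * act_dist P T h\<^sub>1 h\<^sub>2"
proof -
  obtain G where "0 < \<alpha>"
    and grad: "\<And>z h a. z \<in> actions P T F \<Longrightarrow> h \<in> actions P T F \<Longrightarrow> a \<in> actions P T F \<Longrightarrow>
      has_gateaux_gradient P T F (\<lambda>a. U a z h) (G a z h) a"
    and conc: "\<And>z h. z \<in> actions P T F \<Longrightarrow> h \<in> actions P T F \<Longrightarrow> strongly_concave P T F \<alpha> (\<lambda>a. U a z h)"
    and lip: "\<And>a. a \<in> actions P T F \<Longrightarrow> act_dist P T (G a z\<^sub>1 h\<^sub>1) (G a z\<^sub>2 h\<^sub>2)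
      \<le> l\<^sub>U * act_dist P T z\<^sub>1 z\<^sub>2 + l\<^sub>\<theta> * act_dist P T h\<^sub>1 h\<^sub>2"
    using A1 z h unfolding assumption_A1_def by blast
  show ?thesis
    by (rule arg_max_stability[OF \<open>0 < \<alpha>\<close> conc[OF z(1) h(1)] conc[OF z(2) h(2)]
        grad[OF z(1) h(1)] grad[OF z(2) h(2)] lip C max])
qed

end

section \<open>Action profiles and the fixed point\<close>

locale graphon_profiles = process_space P T F + kernel_operator N W
  for P :: "'w measure" and T F N W +
  assumes space_N: "space N = {0..1}"
begin

definition joint :: "'w profile \<Rightarrow> real \<times> real \<times> 'w \<Rightarrow> real" where
  "joint a = (\<lambda>(x, t, w). a x t w)"

text \<open>Defined through the players, so that estimates valid for each player can be integrated
  directly; \<open>profile_dist_eq\<close> turns it into the L2 distance on the product, where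
  completeness and the operator norm apply.\<close>

definition profile_dist :: "'w profile \<Rightarrow> 'w profile \<Rightarrow> real" where
  "profile_dist a b = L2_norm N (\<lambda>x. act_dist P T (a x) (b x))"

abbreviation profiles :: "'w profile set" where
  "profiles \<equiv> action_profiles N P T F"

lemma joint_section: "(\<lambda>z. joint a (x, z)) = case_prod (a x)"
  by (auto simp: joint_def)

lemma measurable_profile_iff: "measurable_profile N P T a \<longleftrightarrow> joint a \<in> borel_measurable (N \<Otimes>\<^sub>M M)"
  by (simp add: measurable_profile_def joint_def)

lemma nn_integral_profile:
  assumes a[measurable]: "joint a \<in> borel_measurable (N \<Otimes>\<^sub>M M)"
  shows "(\<integral>\<^sup>+x. (\<integral>\<^sup>+t. (\<integral>\<^sup>+w. ennreal ((a x t w)\<^sup>2) \<partial>P) \<partial>time_measure T) \<partial>N)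
    = (\<integral>\<^sup>+z. ennreal ((joint a z)\<^sup>2) \<partial>(N \<Otimes>\<^sub>M M))"
proof -
  have "(\<integral>\<^sup>+x. (\<integral>\<^sup>+t. (\<integral>\<^sup>+w. ennreal ((a x t w)\<^sup>2) \<partial>P) \<partial>time_measure T) \<partial>N)
      = (\<integral>\<^sup>+x. (\<integral>\<^sup>+z. ennreal ((joint a (x, z))\<^sup>2) \<partial>M) \<partial>N)"
  proof (rule nn_integral_cong)
    fix x assume "x \<in> space N"
    then have "case_prod (a x) \<in> borel_measurable M"
      using measurable_compose[OF measurable_Pair1' a] by (simp add: joint_section)
    then show "(\<integral>\<^sup>+t. (\<integral>\<^sup>+w. ennreal ((a x t w)\<^sup>2) \<partial>P) \<partial>time_measure T) = (\<integral>\<^sup>+z. ennreal ((joint a (x, z))\<^sup>2) \<partial>M)"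
      by (simp add: nn_integral_process fun_cong[OF joint_section])
  qed
  also have "\<dots> = (\<integral>\<^sup>+z. ennreal ((joint a z)\<^sup>2) \<partial>(N \<Otimes>\<^sub>M M))"
    by (rule pair.P.nn_integral_fst) measurable
  finally show ?thesis .
qed

lemma profiles_iff: "a \<in> profiles \<longleftrightarrow> joint a \<in> L2 (N \<Otimes>\<^sub>M M) \<and> (\<forall>x \<in> space N. a x \<in> actions P T F)"
  unfolding action_profiles_def L2_iff_nn_integral measurable_profile_iff space_N
  by (auto simp: nn_integral_profile)

lemma profiles_L2: "a \<in> profiles \<Longrightarrow> joint a \<in> L2 (N \<Otimes>\<^sub>M M)"
  by (simp add: profiles_iff)

lemma profiles_section: "a \<in> profiles \<Longrightarrow> x \<in> space N \<Longrightarrow> a x \<in> actions P T F"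
  by (simp add: profiles_iff)

lemma act_norm_profile_measurable:
  assumes "joint a \<in> borel_measurable (N \<Otimes>\<^sub>M M)" and "\<And>x. x \<in> space N \<Longrightarrow> a x \<in> actions P T F"
  shows "(\<lambda>x. act_norm P T (a x)) \<in> borel_measurable N"
proof -
  note [measurable] = assms(1)
  have "(\<lambda>x. sqrt (\<integral>z. (joint a (x, z))\<^sup>2 \<partial>M)) \<in> borel_measurable N"
    by measurable
  also have "?this \<longleftrightarrow> ?thesis"
    by (intro measurable_cong)
      (simp add: act_norm_eq[OF actions_L2[OF assms(2)]] L2_norm_def fun_cong[OF joint_section])
  finally show ?thesis .
qed

lemma nn_integral_act_norm:
  assumes a: "joint a \<in> borel_measurable (N \<Otimes>\<^sub>M M)" "\<And>x. x \<in> space N \<Longrightarrow> a x \<in> actions P T F"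
  shows "(\<integral>\<^sup>+x. ennreal ((act_norm P T (a x))\<^sup>2) \<partial>N) = (\<integral>\<^sup>+z. ennreal ((joint a z)\<^sup>2) \<partial>(N \<Otimes>\<^sub>M M))"
proof -
  note [measurable] = a(1)
  have "(\<integral>\<^sup>+x. ennreal ((act_norm P T (a x))\<^sup>2) \<partial>N) = (\<integral>\<^sup>+x. (\<integral>\<^sup>+z. ennreal ((joint a (x, z))\<^sup>2) \<partial>M) \<partial>N)"
    by (intro nn_integral_cong)
      (simp add: act_norm_eq[OF actions_L2[OF a(2)]] L2_nn_integral[OF actions_L2[OF a(2)], symmetric] fun_cong[OF joint_section])
  also have "\<dots> = (\<integral>\<^sup>+z. ennreal ((joint a z)\<^sup>2) \<partial>(N \<Otimes>\<^sub>M M))"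
    by (rule pair.P.nn_integral_fst) measurable
  finally show ?thesis .
qed

lemma profiles_act_norm:
  assumes a: "a \<in> profiles"
  shows "(\<lambda>x. act_norm P T (a x)) \<in> L2 N"
    and "L2_norm N (\<lambda>x. act_norm P T (a x)) = L2_norm (N \<Otimes>\<^sub>M M) (joint a)"
proof -
  note aL2 = profiles_L2[OF a]
  note meas = L2_measurable[OF aL2] profiles_section[OF a]
  show L2: "(\<lambda>x. act_norm P T (a x)) \<in> L2 N"
    using aL2 act_norm_profile_measurable[OF meas] by (simp add: L2_iff_nn_integral nn_integral_act_norm[OF meas])
  have "ennreal ((L2_norm N (\<lambda>x. act_norm P T (a x)))\<^sup>2) = ennreal ((L2_norm (N \<Otimes>\<^sub>M M) (joint a))\<^sup>2)"
    unfolding L2_nn_integral[OF L2, symmetric] L2_nn_integral[OF aL2, symmetric] by (rule nn_integral_act_norm[OF meas])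
  then show "L2_norm N (\<lambda>x. act_norm P T (a x)) = L2_norm (N \<Otimes>\<^sub>M M) (joint a)"
    by (simp add: L2_norm_nonneg)
qed

lemma profilesI:
  assumes a: "measurable_profile N P T a" "\<And>x. x \<in> space N \<Longrightarrow> a x \<in> actions P T F"
    and f: "f \<in> L2 N" "\<And>x. x \<in> space N \<Longrightarrow> act_norm P T (a x) \<le> f x"
  shows "a \<in> profiles"
proof -
  have meas: "joint a \<in> borel_measurable (N \<Otimes>\<^sub>M M)"
    using a(1) by (simp add: measurable_profile_iff)
  have "(\<integral>\<^sup>+z. ennreal ((joint a z)\<^sup>2) \<partial>(N \<Otimes>\<^sub>M M)) = (\<integral>\<^sup>+x. ennreal ((act_norm P T (a x))\<^sup>2) \<partial>N)"
    by (rule nn_integral_act_norm[symmetric, OF meas a(2)])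
  also have "\<dots> \<le> (\<integral>\<^sup>+x. ennreal ((f x)\<^sup>2) \<partial>N)"
    using f(2) by (intro nn_integral_mono ennreal_leI power_mono) (auto simp: act_norm_eq[OF actions_L2[OF a(2)]] L2_norm_nonneg)
  also have "\<dots> < \<infinity>"
    using f(1) by (simp add: L2_iff_nn_integral)
  finally show ?thesis
    using meas a(2) by (simp add: profiles_iff L2_iff_nn_integral)
qed

lemma profiles_diff:
  assumes "a \<in> profiles" "b \<in> profiles"
  shows "(\<lambda>x t w. a x t w - b x t w) \<in> profiles"
proof -
  have "joint (\<lambda>x t w. a x t w - b x t w) = (\<lambda>z. joint a z - joint b z)"
    by (auto simp: joint_def)
  then show ?thesis
    using assms by (auto simp: profiles_iff intro: L2_diff actions_diff)
qed

lemma profiles_const: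
  assumes a: "a \<in> actions P T F"
  shows "(\<lambda>x. a) \<in> profiles"
proof (rule profilesI)
  note [measurable] = L2_measurable[OF actions_L2[OF a]]
  have "joint (\<lambda>x. a) = (\<lambda>z. case_prod a (snd z))"
    by (auto simp: joint_def)
  then show "measurable_profile N P T (\<lambda>x. a)"
    by (simp add: measurable_profile_iff)
  show "(\<lambda>x. act_norm P T a) \<in> L2 N"
    by (simp add: L2_def)
qed (use a in auto)

lemma act_dist_L2:
  assumes "a \<in> profiles" "b \<in> profiles"
  shows "(\<lambda>x. act_dist P T (a x) (b x)) \<in> L2 N"
  using profiles_act_norm(1)[OF profiles_diff[OF assms]] by (simp add: act_dist_def)

lemma profile_dist_eq:
  assumes "a \<in> profiles" "b \<in> profiles"
  shows "profile_dist a b = L2_norm (N \<Otimes>\<^sub>M M) (\<lambda>z. joint a z - joint b z)"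
proof -
  have "joint (\<lambda>x t w. a x t w - b x t w) = (\<lambda>z. joint a z - joint b z)"
    by (auto simp: joint_def)
  then show ?thesis
    using profiles_act_norm(2)[OF profiles_diff[OF assms]] by (simp add: profile_dist_def act_dist_def)
qed

lemma profile_dist_nonneg: "0 \<le> profile_dist a b"
  by (simp add: profile_dist_def L2_norm_nonneg)

lemma profile_dist_mono:
  assumes ab: "a \<in> profiles" "b \<in> profiles" and z: "z \<in> profiles" "z' \<in> profiles"
    and "0 < \<alpha>"
    and le: "\<And>x. x \<in> space N \<Longrightarrow> \<alpha> * act_dist P T (a x) (b x) \<le> L * act_dist P T (z x) (z' x)"
    and L: "0 \<le> L"
  shows "\<alpha> * profile_dist a b \<le> L * profile_dist z z'"
proof -
  have "L2_norm N (\<lambda>x. \<alpha> * act_dist P T (a x) (b x)) \<le> L2_norm N (\<lambda>x. L * act_dist P T (z x) (z' x))"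
  proof (rule L2_norm_mono)
    fix x assume x: "x \<in> space N"
    have "0 \<le> \<alpha> * act_dist P T (a x) (b x)"
      using \<open>0 < \<alpha>\<close> act_dist_nonneg[OF profiles_section[OF ab(1) x] profiles_section[OF ab(2) x]] by simp
    then show "\<bar>\<alpha> * act_dist P T (a x) (b x)\<bar> \<le> L * act_dist P T (z x) (z' x)"
      using le[OF x] by linarith
  qed (intro L2_scale act_dist_L2 ab z)+
  then show ?thesis
    using \<open>0 < \<alpha>\<close> L by (simp add: L2_norm_scale profile_dist_def)
qed

section \<open>The local aggregate of a profile\<close>

abbreviation aggregate :: "'w profile \<Rightarrow> 'w profile" where
  "aggregate \<equiv> local_aggregate N W"

lemma joint_aggregate: "joint (aggregate a) = lift (joint a)"
  by (auto simp: joint_def lift_def local_aggregate_def)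

text \<open>With x fixed, \<open>K_abs_le\<close> is applied in almost every fibre and integrated
  over m. The factor is 1 and not \<open>op_norm\<close>, because the operator norm controls only
  the L2 average over players.\<close>

lemma lift_section_diff:
  assumes a: "a \<in> L2 (N \<Otimes>\<^sub>M M)" and b: "b \<in> L2 (N \<Otimes>\<^sub>M M)" and x: "x \<in> space N"
  shows "(\<lambda>m. lift a (x, m) - lift b (x, m)) \<in> L2 M"
    and "L2_norm M (\<lambda>m. lift a (x, m) - lift b (x, m)) \<le> L2_norm (N \<Otimes>\<^sub>M M) (\<lambda>z. a z - b z)"
proof -
  have sf: "sigma_finite_measure N" "sigma_finite_measure M"
    by unfold_locales
  let ?d = "\<lambda>z. a z - b z"
  have d: "?d \<in> L2 (N \<Otimes>\<^sub>M M)"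
    by (rule L2_diff[OF a b])
  have meas: "(\<lambda>m. lift a (x, m) - lift b (x, m)) \<in> borel_measurable M"
    using L2_measurable[OF a] L2_measurable[OF b]
    by (intro borel_measurable_diff measurable_compose[OF measurable_Pair1'[OF x] lift_measurable])
  have "(\<integral>\<^sup>+m. ennreal ((lift a (x, m) - lift b (x, m))\<^sup>2) \<partial>M) \<le> (\<integral>\<^sup>+m. ennreal ((L2_norm N (\<lambda>y. ?d (y, m)))\<^sup>2) \<partial>M)"
  proof (rule nn_integral_mono_AE)
    show "AE m in M. ennreal ((lift a (x, m) - lift b (x, m))\<^sup>2) \<le> ennreal ((L2_norm N (\<lambda>y. ?d (y, m)))\<^sup>2)"
      using L2_pair_sections(1)[OF sf a] L2_pair_sections(1)[OF sf b]
    proof eventually_elim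
      case (elim m)
      have "lift a (x, m) - lift b (x, m) = K (\<lambda>y. ?d (y, m)) x"
        using elim x by (simp add: lift_def K_diff)
      then have "\<bar>lift a (x, m) - lift b (x, m)\<bar> \<le> L2_norm N (\<lambda>y. ?d (y, m))"
        using K_abs_le[OF x L2_diff[OF elim]] by simp
      then show ?case
        by (intro ennreal_leI) (simp add: abs_le_square_iff[symmetric] L2_norm_nonneg)
    qed
  qed
  also have "\<dots> = ennreal ((L2_norm (N \<Otimes>\<^sub>M M) ?d)\<^sup>2)"
    unfolding L2_pair_sections(3)[OF sf d]
    by (intro nn_integral_eq_integral L2_pair_sections(2)[OF sf d]) simp
  finally have "(\<integral>\<^sup>+m. ennreal ((lift a (x, m) - lift b (x, m))\<^sup>2) \<partial>M) \<le> ennreal ((L2_norm (N \<Otimes>\<^sub>M M) ?d)\<^sup>2)" .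
  from L2_norm_leI[OF meas L2_norm_nonneg this]
  show "(\<lambda>m. lift a (x, m) - lift b (x, m)) \<in> L2 M"
    and "L2_norm M (\<lambda>m. lift a (x, m) - lift b (x, m)) \<le> L2_norm (N \<Otimes>\<^sub>M M) ?d" .
qed

text \<open>The progressive versions of the actions need not depend measurably on the player, so
  integration over players is handled by \<open>integral_sections_AE_measurable\<close> with the
  weight \<open>W x\<close>.\<close>

lemma aggregate_section:
  assumes a: "a \<in> profiles" and x: "x \<in> space N"
  shows "aggregate a x \<in> actions P T F"
proof -
  have sf: "sigma_finite_measure N"
    by unfold_locales
  interpret NM: pair_sigma_finite N M ..
  interpret NM: finite_measure "N \<Otimes>\<^sub>M M"
  proof
    show "emeasure (N \<Otimes>\<^sub>M M) (space (N \<Otimes>\<^sub>M M)) \<noteq> \<infinity>"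
      using M.emeasure_finite by (simp add: space_pair_measure pair.P.emeasure_pair_measure_Times ennreal_mult_eq_top_iff)
  qed
  have eq: "case_prod (aggregate a x) = (\<lambda>m. lift (joint a) (x, m))"
    by (simp only: joint_aggregate[symmetric] joint_section)
  have "case_prod (aggregate a x) \<in> L2 M"
    using lift_section_diff(1)[OF profiles_L2[OF a] L2_zero x] by (simp add: eq lift_zero)
  moreover have "\<exists>p \<in> borel_measurable progressive_algebra. AE m in M. (\<integral>y. W x y * joint a (y, m) \<partial>N) = p m"
  proof (rule integral_sections_AE_measurable[OF sf finite_measure_M subalgebra_progressive])
    show "integrable (N \<Otimes>\<^sub>M M) (joint a)"
      by (rule NM.L2_integrable[OF profiles_L2[OF a]])
    show "W x \<in> borel_measurable N"
      by (rule L2_measurable[OF W_section_L2[OF x]])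
    fix y assume y: "y \<in> space N"
    show "\<bar>W x y\<bar> \<le> 1"
      using x y by (simp add: W_nonneg W_le_1)
    show "integrable M (\<lambda>m. joint a (y, m))"
      unfolding joint_section by (intro M.L2_integrable actions_L2 profiles_section[OF a y])
    show "\<exists>p \<in> borel_measurable progressive_algebra. AE m in M. joint a (y, m) = p m"
      using profiles_section[OF a y] by (simp add: actions_iff fun_cong[OF joint_section])
  qed
  then have "\<exists>p \<in> borel_measurable progressive_algebra. AE m in M. case_prod (aggregate a x) m = p m"
    unfolding eq by (simp add: lift_def graphon_op_def case_prod_beta')
  ultimately show ?thesis
    by (simp add: actions_iff)
qed

lemma aggregate_profiles:
  assumes a: "a \<in> profiles"
  shows "aggregate a \<in> profiles"
proof -
  have "sigma_finite_measure M"
    by unfold_locales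
  then show ?thesis
    using lift_L2(1)[OF _ profiles_L2[OF a]] aggregate_section[OF a] by (simp add: profiles_iff joint_aggregate)
qed

lemma aggregate_section_dist:
  assumes a: "a \<in> profiles" and b: "b \<in> profiles" and x: "x \<in> space N"
  shows "act_dist P T (aggregate a x) (aggregate b x) \<le> profile_dist a b"
proof -
  have eq: "case_prod (aggregate c x) = (\<lambda>m. lift (joint c) (x, m))" for c
    by (simp only: joint_aggregate[symmetric] joint_section)
  show ?thesis
    using lift_section_diff(2)[OF profiles_L2[OF a] profiles_L2[OF b] x]
    by (simp only: act_dist_eq[OF actions_L2[OF aggregate_section[OF a x]] actions_L2[OF aggregate_section[OF b x]]]
        eq profile_dist_eq[OF a b])
qed

lemma aggregate_dist:
  assumes a: "a \<in> profiles" and b: "b \<in> profiles"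
  shows "profile_dist (aggregate a) (aggregate b) \<le> lambda_1 N W * profile_dist a b"
proof -
  have "sigma_finite_measure M"
    by unfold_locales
  then show ?thesis
    using lift_diff_norm(2)[OF _ profiles_L2[OF a] profiles_L2[OF b]]
    by (simp add: profile_dist_eq a b aggregate_profiles joint_aggregate lambda_1_eq_op_norm)
qed

end

text \<open>Differentiability and concavity of \<open>U\<close> enter the fixed-point argument
  through \<open>stability\<close> alone; \<open>L\<close> plays the part of the Lipschitz constant
  in the aggregate.\<close>

locale contractive_graphon_game = graphon_profiles P T F N W
  for P :: "'w measure" and T F N W +
  fixes U :: "'w utility" and A :: "real \<Rightarrow> 'w process set" and \<theta> :: "'w profile" and \<alpha> L l\<^sub>\<theta> :: real
  assumes \<theta>: "\<theta> \<in> profiles"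
    and U: "utility_functional P T F U"
    and A2: "assumption_A2 N P T F U A"
    and measurable_replies: "measurable_best_responses N P T F U A \<theta>"
    and \<alpha>_pos: "0 < \<alpha>" and L_nonneg: "0 \<le> L" and contractive: "L * lambda_1 N W < \<alpha>"
    and stability: "\<And>C z\<^sub>1 z\<^sub>2 h\<^sub>1 h\<^sub>2 a\<^sub>1 a\<^sub>2. C \<subseteq> actions P T F \<Longrightarrow> convex_actions C \<Longrightarrow>
      z\<^sub>1 \<in> actions P T F \<Longrightarrow> z\<^sub>2 \<in> actions P T F \<Longrightarrow> h\<^sub>1 \<in> actions P T F \<Longrightarrow> h\<^sub>2 \<in> actions P T F \<Longrightarrow>
      is_arg_max (\<lambda>a. U a z\<^sub>1 h\<^sub>1) (\<lambda>a. a \<in> C) a\<^sub>1 \<Longrightarrow> is_arg_max (\<lambda>a. U a z\<^sub>2 h\<^sub>2) (\<lambda>a. a \<in> C) a\<^sub>2 \<Longrightarrow>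
      \<alpha> * act_dist P T a\<^sub>1 a\<^sub>2 \<le> L * act_dist P T z\<^sub>1 z\<^sub>2 + l\<^sub>\<theta> * act_dist P T h\<^sub>1 h\<^sub>2"
begin

section \<open>Best replies to a profile\<close>

lemma A_actions: "x \<in> space N \<Longrightarrow> A x \<subseteq> actions P T F"
  and A_convex: "x \<in> space N \<Longrightarrow> convex_actions (A x)"
  and A_closed: "x \<in> space N \<Longrightarrow> closed_actions P T F (A x)"
  using A2 by (auto simp: assumption_A2_def space_N)

lemma best_response_in_A: "best_response U A z h b \<Longrightarrow> x \<in> space N \<Longrightarrow> b x \<in> A x"
  by (simp add: best_response_def is_arg_max_def space_N)

lemma best_response_dist:
  assumes "best_response U A z h b" "best_response U A z' h' b'" and x: "x \<in> space N"
    and "z x \<in> actions P T F" "z' x \<in> actions P T F" "h x \<in> actions P T F" "h' x \<in> actions P T F"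
  shows "\<alpha> * act_dist P T (b x) (b' x) \<le> L * act_dist P T (z x) (z' x) + l\<^sub>\<theta> * act_dist P T (h x) (h' x)"
  using assms by (intro stability[OF A_actions[OF x] A_convex[OF x]]) (auto simp: best_response_def space_N)

lemma best_response_dist_same:
  assumes "best_response U A z \<theta> b" "best_response U A z' \<theta> b'" and x: "x \<in> space N"
    and "z x \<in> actions P T F" "z' x \<in> actions P T F"
  shows "\<alpha> * act_dist P T (b x) (b' x) \<le> L * act_dist P T (z x) (z' x)"
  using best_response_dist[OF assms profiles_section[OF \<theta> x] profiles_section[OF \<theta> x]]
  by (simp add: act_dist_self profiles_section[OF \<theta> x])

text \<open>The measurable choice provides a candidate. Its square integrability comes from
  \<open>stability\<close>, which compares it player by player with the square-integrable reference
  reply of (A2).\<close>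

lemma best_response_exists:
  assumes z: "z \<in> profiles"
  shows "\<exists>b \<in> profiles. best_response U A z \<theta> b"
proof -
  obtain b where b: "measurable_profile N P T b" "best_response U A z \<theta> b"
    using measurable_replies z by (auto simp: measurable_best_responses_def)
  obtain z\<^sub>0 \<theta>\<^sub>0 b\<^sub>0 where ref: "z\<^sub>0 \<in> actions P T F" "\<theta>\<^sub>0 \<in> actions P T F" "b\<^sub>0 \<in> profiles"
    "best_response U A (\<lambda>x. z\<^sub>0) (\<lambda>x. \<theta>\<^sub>0) b\<^sub>0"
    using A2 by (auto simp: assumption_A2_def)
  note z0 = profiles_const[OF ref(1)] and \<theta>0 = profiles_const[OF ref(2)]
  have bA: "b x \<in> actions P T F" if "x \<in> space N" for x
    using best_response_in_A[OF b(2) that] A_actions[OF that] by auto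
  have "b \<in> profiles"
  proof (rule profilesI[OF b(1) bA])
    show "(\<lambda>x. act_norm P T (b\<^sub>0 x) + (L / \<alpha> * act_dist P T (z x) z\<^sub>0 + l\<^sub>\<theta> / \<alpha> * act_dist P T (\<theta> x) \<theta>\<^sub>0)) \<in> L2 N"
      using act_dist_L2[OF z z0] act_dist_L2[OF \<theta> \<theta>0] by (intro L2_add L2_scale profiles_act_norm ref)
    fix x assume x: "x \<in> space N"
    note b0x = profiles_section[OF ref(3) x]
    have "act_norm P T (b x) \<le> act_dist P T (b x) (b\<^sub>0 x) + act_norm P T (b\<^sub>0 x)"
      using L2_norm_le_diff[OF actions_L2[OF bA[OF x]] actions_L2[OF b0x]]
      by (simp add: act_norm_eq act_dist_eq actions_L2 bA[OF x] b0x)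
    moreover have "\<alpha> * act_dist P T (b x) (b\<^sub>0 x) \<le> L * act_dist P T (z x) z\<^sub>0 + l\<^sub>\<theta> * act_dist P T (\<theta> x) \<theta>\<^sub>0"
      using best_response_dist[OF b(2) ref(4) x] profiles_section[OF z x] profiles_section[OF \<theta> x] ref by simp
    then have "act_dist P T (b x) (b\<^sub>0 x) \<le> L / \<alpha> * act_dist P T (z x) z\<^sub>0 + l\<^sub>\<theta> / \<alpha> * act_dist P T (\<theta> x) \<theta>\<^sub>0"
      using \<alpha>_pos by (simp add: field_simps)
    ultimately show "act_norm P T (b x)
        \<le> act_norm P T (b\<^sub>0 x) + (L / \<alpha> * act_dist P T (z x) z\<^sub>0 + l\<^sub>\<theta> / \<alpha> * act_dist P T (\<theta> x) \<theta>\<^sub>0)"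
      by linarith
  qed
  then show ?thesis
    using b(2) by blast
qed

text \<open>Best replies are determined only as classes, so a representative has to be
  chosen.\<close>

definition reply :: "'w profile \<Rightarrow> 'w profile" where
  "reply a = (SOME b. b \<in> profiles \<and> best_response U A (aggregate a) \<theta> b)"

lemma reply:
  assumes "a \<in> profiles"
  shows "reply a \<in> profiles" "best_response U A (aggregate a) \<theta> (reply a)"
  using someI_ex[of "\<lambda>b. b \<in> profiles \<and> best_response U A (aggregate a) \<theta> b"]
    best_response_exists[OF aggregate_profiles[OF assms]]
  by (auto simp: reply_def)

text \<open>For a single player the factor \<open>lambda_1\<close> is lost. This does no harm, since
  the estimate is applied once, on top of a bound on the profile distance, and is never
  iterated.\<close>

lemma best_response_section_dist:
  assumes ab: "a \<in> profiles" "b \<in> profiles"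
    and best: "best_response U A (aggregate a) \<theta> a'" "best_response U A (aggregate b) \<theta> b'"
    and x: "x \<in> space N"
  shows "\<alpha> * act_dist P T (a' x) (b' x) \<le> L * profile_dist a b"
  using best_response_dist_same[OF best x] aggregate_section[OF ab(1) x] aggregate_section[OF ab(2) x]
    mult_left_mono[OF aggregate_section_dist[OF ab x] L_nonneg] by linarith

lemma best_response_profile_dist:
  assumes ab: "a \<in> profiles" "b \<in> profiles" and ab': "a' \<in> profiles" "b' \<in> profiles"
    and best: "best_response U A (aggregate a) \<theta> a'" "best_response U A (aggregate b) \<theta> b'"
  shows "profile_dist a' b' \<le> L * lambda_1 N W / \<alpha> * profile_dist a b"
proof -
  have "\<alpha> * profile_dist a' b' \<le> L * profile_dist (aggregate a) (aggregate b)"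
    using aggregate_section[OF ab(1)] aggregate_section[OF ab(2)]
    by (intro profile_dist_mono[OF ab' aggregate_profiles[OF ab(1)] aggregate_profiles[OF ab(2)] \<alpha>_pos _ L_nonneg]
        best_response_dist_same[OF best]) auto
  also have "\<dots> \<le> L * (lambda_1 N W * profile_dist a b)"
    by (intro mult_left_mono aggregate_dist ab L_nonneg)
  finally show ?thesis
    using \<alpha>_pos by (simp add: field_simps)
qed

lemma nash_equilibrium_unique:
  assumes "nash_equilibrium N P T F A U \<theta> W a" "nash_equilibrium N P T F A U \<theta> W b" and x: "x \<in> space N"
  shows "same_process P T (a x) (b x)"
proof -
  have ab: "a \<in> profiles" "b \<in> profiles"
    and best: "best_response U A (aggregate a) \<theta> a" "best_response U A (aggregate b) \<theta> b"
    using assms by (auto simp: nash_equilibrium_def admissible_profiles_def)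
  have "L * lambda_1 N W / \<alpha> < 1"
    using contractive \<alpha>_pos by simp
  then have "profile_dist a b = 0"
    using best_response_profile_dist[OF ab ab best] profile_dist_nonneg[of a b]
    by (smt (verit, best) mult_less_cancel_right2)
  \<comment> \<open>Profile distance 0 means equality for almost every player; both profiles being
    replies to themselves extends it to every player.\<close>
  then have "\<alpha> * act_dist P T (a x) (b x) \<le> 0"
    using best_response_section_dist[OF ab best x] by simp
  then have "act_dist P T (a x) (b x) = 0"
    using \<alpha>_pos act_dist_nonneg[OF profiles_section[OF ab(1) x] profiles_section[OF ab(2) x]]
    by (simp add: mult_le_0_iff)
  then show ?thesis
    by (simp add: same_process_iff_dist[OF profiles_section[OF ab(1) x] profiles_section[OF ab(2) x]])
qed

text \<open>
  The best-reply map contracts only the \<open>L\<^sup>2\<close> distance between profiles, but one more reply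
  bounds the distance of every single player's actions by it, so the iterates converge for every
  player and not merely for almost every one.
\<close>

lemma nash_equilibrium_exists: "\<exists>a. nash_equilibrium N P T F A U \<theta> W a"
proof -
  define r where "r = L * lambda_1 N W / \<alpha>"
  have r: "0 \<le> r" "r < 1"
    using contractive \<alpha>_pos L_nonneg lambda_1_nonneg by (simp_all add: r_def)
  obtain b\<^sub>0 where b0: "b\<^sub>0 \<in> profiles"
    using A2 by (auto simp: assumption_A2_def)
  define s where "s n = (reply ^^ Suc n) b\<^sub>0" for n
  have s_Suc: "s (Suc n) = reply (s n)" for n
    by (simp add: s_def)
  have s: "s n \<in> profiles" for n
    by (induction n) (use b0 reply(1) in \<open>auto simp: s_def\<close>)
  have s_best: "best_response U A (aggregate (s n)) \<theta> (s (Suc n))" for n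
    unfolding s_Suc by (rule reply(2)[OF s])
  have s_A: "s (Suc n) x \<in> A x" if "x \<in> space N" for n x
    by (rule best_response_in_A[OF s_best that])
  let ?D = "profile_dist (s 1) (s 0)"
  have step: "profile_dist (s (Suc n)) (s n) \<le> ?D * r ^ n" for n
  proof (induction n)
    case (Suc n)
    have "profile_dist (s (Suc (Suc n))) (s (Suc n)) \<le> r * profile_dist (s (Suc n)) (s n)"
      unfolding r_def by (rule best_response_profile_dist[OF s s s s s_best s_best])
    also have "\<dots> \<le> r * (?D * r ^ n)"
      by (rule mult_left_mono[OF Suc r(1)])
    finally show ?case
      by (simp add: mult_ac)
  qed simp
  have step_section: "act_dist P T (s (Suc (Suc n)) x) (s (Suc n) x) \<le> L / \<alpha> * ?D * r ^ n" if x: "x \<in> space N" for n x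
  proof -
    have "\<alpha> * act_dist P T (s (Suc (Suc n)) x) (s (Suc n) x) \<le> L * profile_dist (s (Suc n)) (s n)"
      by (rule best_response_section_dist[OF s s s_best s_best x])
    also have "\<dots> \<le> L * (?D * r ^ n)"
      by (intro mult_left_mono step L_nonneg)
    finally show ?thesis
      using \<alpha>_pos by (simp add: field_simps)
  qed
  \<comment> \<open>The limit runs over \<open>s (Suc n)\<close> because \<open>step_section\<close>
    bounds increments only from index 1 on. As a pointwise \<open>lim\<close>, the same
    \<open>a\<close> is the limit for each player and on the product space.\<close>
  define a where "a x t w = lim (\<lambda>n. s (Suc n) x t w)" for x t w
  have sx: "s n x \<in> actions P T F" if "x \<in> space N" for n x
    by (rule profiles_section[OF s that])
  have a_x: "a x \<in> actions P T F \<and> (\<lambda>n. act_dist P T (s (Suc n) x) (a x)) \<longlonglongrightarrow> 0" if x: "x \<in> space N" for x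
  proof -
    have geom: "L2_norm M (\<lambda>z. case_prod (s (Suc (Suc n)) x) z - case_prod (s (Suc n) x) z) \<le> L / \<alpha> * ?D * r ^ n" for n
      using step_section[OF x, of n] by (simp only: act_dist_eq[OF actions_L2[OF sx[OF x]] actions_L2[OF sx[OF x]]])
    have a_eq: "case_prod (a x) = (\<lambda>z. lim (\<lambda>n. case_prod (s (Suc n) x) z))"
      by (auto simp: a_def)
    note lim = M.L2_complete_geometric[of "\<lambda>n. case_prod (s (Suc n) x)", OF actions_L2[OF sx[OF x]] geom r, folded a_eq]
    have ax: "a x \<in> actions P T F"
      by (rule actions_limit[OF sx[OF x] lim(2)]) (use lim(1) in \<open>simp add: fun_cong[OF a_eq]\<close>)
    have "(\<lambda>n. act_dist P T (s (Suc n) x) (a x)) \<longlonglongrightarrow> 0"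
    proof (rule tendsto_sandwich[OF always_eventually always_eventually tendsto_const])
      show "\<forall>n. 0 \<le> act_dist P T (s (Suc n) x) (a x)"
        using act_dist_nonneg[OF sx[OF x] ax] by blast
      show "\<forall>n. act_dist P T (s (Suc n) x) (a x) \<le> L / \<alpha> * ?D * r ^ n / (1 - r)"
        using lim(3) by (simp only: act_dist_eq[OF actions_L2[OF sx[OF x]] lim(2)] a_eq) blast
      have "(\<lambda>n. L / \<alpha> * ?D * r ^ n / (1 - r)) \<longlonglongrightarrow> L / \<alpha> * ?D * 0 / (1 - r)"
        using r by (intro tendsto_intros LIMSEQ_power_zero) auto
      then show "(\<lambda>n. L / \<alpha> * ?D * r ^ n / (1 - r)) \<longlonglongrightarrow> 0"
        by simp
    qed
    then show ?thesis
      using ax by blast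
  qed
  have a_A: "a x \<in> A x" if x: "x \<in> space N" for x
  proof -
    have "(\<forall>n. s (Suc n) x \<in> A x) \<and> a x \<in> actions P T F \<and> (\<lambda>n. act_dist P T (s (Suc n) x) (a x)) \<longlonglongrightarrow> 0"
      using s_A[OF x] a_x[OF x] by blast
    then show ?thesis
      using A_closed[OF x, unfolded closed_actions_def, THEN spec[of _ "\<lambda>n. s (Suc n) x"], THEN spec[of _ "a x"]]
      by (rule rev_mp)
  qed
  interpret NM: pair_sigma_finite N M ..
  have fin: "finite_measure (N \<Otimes>\<^sub>M M)"
  proof
    show "emeasure (N \<Otimes>\<^sub>M M) (space (N \<Otimes>\<^sub>M M)) \<noteq> \<infinity>"
      using M.emeasure_finite by (simp add: space_pair_measure pair.P.emeasure_pair_measure_Times ennreal_mult_eq_top_iff)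
  qed
  have joint_a: "joint a = (\<lambda>z. lim (\<lambda>n. joint (s (Suc n)) z))"
    by (auto simp: joint_def a_def)
  \<comment> \<open>The extra factor r accounts for starting at index 1.\<close>
  have geom: "L2_norm (N \<Otimes>\<^sub>M M) (\<lambda>z. joint (s (Suc (Suc n))) z - joint (s (Suc n)) z) \<le> (?D * r) * r ^ n" for n
    using step[of "Suc n"] by (simp add: profile_dist_eq[OF s s] mult.assoc)
  note lim = finite_measure.L2_complete_geometric[OF fin, of "\<lambda>n. joint (s (Suc n))", OF profiles_L2[OF s] geom r, folded joint_a]
  have a: "a \<in> profiles"
    using lim(2) a_x by (simp add: profiles_iff)
  have a_lim: "(\<lambda>n. profile_dist a (s (Suc n))) \<longlonglongrightarrow> 0"
  proof (rule tendsto_sandwich[OF always_eventually always_eventually tendsto_const])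
    show "\<forall>n. 0 \<le> profile_dist a (s (Suc n))"
      by (simp add: profile_dist_nonneg)
    show "\<forall>n. profile_dist a (s (Suc n)) \<le> ?D * r * r ^ n / (1 - r)"
    proof
      fix n
      show "profile_dist a (s (Suc n)) \<le> ?D * r * r ^ n / (1 - r)"
        unfolding profile_dist_eq[OF a s] L2_norm_minus_commute[of _ "joint a" "joint (s (Suc n))"]
        using lim(3)[of n] by (simp only: fun_cong[OF joint_a])
    qed
    have "(\<lambda>n. ?D * r * r ^ n / (1 - r)) \<longlonglongrightarrow> ?D * r * 0 / (1 - r)"
      using r by (intro tendsto_intros LIMSEQ_power_zero) auto
    then show "(\<lambda>n. ?D * r * r ^ n / (1 - r)) \<longlonglongrightarrow> 0"
      by simp
  qed
  \<comment> \<open>\<open>s (Suc (Suc n))\<close> replies to \<open>s (Suc n)\<close>. It tends to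
    \<open>a x\<close> by construction, and to \<open>reply a x\<close> because replies are
    Lipschitz in the profile, so both limits are the same class for every player.\<close>
  have same: "same_process P T (reply a x) (a x)" if x: "x \<in> space N" for x
  proof -
    have rx: "reply a x \<in> actions P T F"
      by (rule profiles_section[OF reply(1)[OF a] x])
    have ax: "a x \<in> actions P T F"
      using a_x[OF x] by blast
    have "act_dist P T (reply a x) (a x) \<le> 0"
    proof (rule LIMSEQ_le_const)
      have "(\<lambda>n. L / \<alpha> * profile_dist a (s (Suc n)) + act_dist P T (s (Suc (Suc n)) x) (a x)) \<longlonglongrightarrow> L / \<alpha> * 0 + 0"
        by (rule tendsto_add[OF tendsto_mult_left[OF a_lim] LIMSEQ_Suc[OF conjunct2[OF a_x[OF x]]]])
      then show "(\<lambda>n. L / \<alpha> * profile_dist a (s (Suc n)) + act_dist P T (s (Suc (Suc n)) x) (a x)) \<longlonglongrightarrow> 0"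
        by simp
      show "\<exists>k. \<forall>n\<ge>k. act_dist P T (reply a x) (a x)
          \<le> L / \<alpha> * profile_dist a (s (Suc n)) + act_dist P T (s (Suc (Suc n)) x) (a x)"
      proof (intro exI allI impI)
        fix n
        have "act_dist P T (reply a x) (a x) \<le> act_dist P T (reply a x) (s (Suc (Suc n)) x) + act_dist P T (s (Suc (Suc n)) x) (a x)"
          by (rule act_dist_triangle[OF rx sx[OF x] ax])
        moreover have "\<alpha> * act_dist P T (reply a x) (s (Suc (Suc n)) x) \<le> L * profile_dist a (s (Suc n))"
          by (rule best_response_section_dist[OF a s reply(2)[OF a] s_best x])
        then have "act_dist P T (reply a x) (s (Suc (Suc n)) x) \<le> L / \<alpha> * profile_dist a (s (Suc n))"
          using \<alpha>_pos by (simp add: field_simps)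
        ultimately show "act_dist P T (reply a x) (a x)
            \<le> L / \<alpha> * profile_dist a (s (Suc n)) + act_dist P T (s (Suc (Suc n)) x) (a x)"
          by linarith
      qed
    qed
    then show ?thesis
      using act_dist_nonneg[OF rx ax] by (simp add: same_process_iff_dist[OF rx ax])
  qed
  have "best_response U A (aggregate a) \<theta> a"
    unfolding best_response_def
  proof
    fix x :: real assume "x \<in> {0..1}"
    then have x: "x \<in> space N"
      by (simp add: space_N)
    have refl: "same_process P T c c" for c
      by (simp add: same_process_def)
    \<comment> \<open>Only the chosen representative is known to be a maximiser. \<open>U\<close>
      depends on classes alone, so \<open>a x\<close> attains the same value, and closedness of
      \<open>A x\<close> has already made it admissible.\<close>
    have "U (reply a x) (aggregate a x) (\<theta> x) = U (a x) (aggregate a x) (\<theta> x)"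
      using U profiles_section[OF reply(1)[OF a] x] profiles_section[OF a x] aggregate_section[OF a x]
        profiles_section[OF \<theta> x] same[OF x] refl
      unfolding utility_functional_def by blast
    moreover have "is_arg_max (\<lambda>c. U c (aggregate a x) (\<theta> x)) (\<lambda>c. c \<in> A x) (reply a x)"
      using reply(2)[OF a] x by (simp add: best_response_def space_N)
    ultimately show "is_arg_max (\<lambda>c. U c (aggregate a x) (\<theta> x)) (\<lambda>c. c \<in> A x) (a x)"
      using a_A[OF x] by (simp add: is_arg_max_def)
  qed
  then have "nash_equilibrium N P T F A U \<theta> W a"
    using a a_A by (simp add: nash_equilibrium_def admissible_profiles_def space_N)
  then show ?thesis
    by blast
qed

lemma unique_nash_equilibrium: "unique_nash_equilibrium N P T F A U \<theta> W"
  unfolding unique_nash_equilibrium_def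
  using nash_equilibrium_exists nash_equilibrium_unique by (auto simp: space_N)

end

section \<open>The augmented filtration, and graphons over the extended index space\<close>

lemma subalgebra_aug_filtration:
  assumes "prob_space P" "0 < T"
    and \<theta>: "\<And>x. x \<in> {0..1} \<Longrightarrow> case_prod (\<theta> x) \<in> borel_measurable (time_measure T \<Otimes>\<^sub>M P)"
    and t: "t \<in> {0..T}"
  shows "subalgebra P (aug_filtration P \<theta> t)"
proof -
  let ?G = "{\<theta> x s -` B \<inter> space P | x s B. x \<in> {0..1} \<and> s \<in> {0..t} \<and> B \<in> sets borel} \<union> null_sets P"
  have "\<theta> x s \<in> borel_measurable P" if x: "x \<in> {0..1}" and s: "s \<in> {0..t}" for x s
  proof -
    have "s \<in> space (time_measure T)"
      using s t by (auto simp: time_measure_def space_restrict_space)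
    from measurable_compose[OF measurable_Pair1'[OF this] \<theta>[OF x]] show ?thesis
      by simp
  qed
  then have G: "?G \<subseteq> sets P"
    by (auto intro: measurable_sets)
  then have "sigma_sets (space P) ?G \<subseteq> sets P"
    by (rule sets.sigma_sets_subset)
  moreover have "?G \<subseteq> Pow (space P)"
    using G sets.space_closed by blast
  ultimately show ?thesis
    unfolding subalgebra_def aug_filtration_def
    by (simp add: space_measure_of sets_measure_of)
qed

text \<open>\<open>N\<close> contains the Lebesgue sets, so the identity from \<open>N\<close> to
  the Lebesgue space is measurable and pulls \<open>W\<close> back to the product of
  \<open>N\<close> with itself.\<close>

lemma kernel_operator_graphon:
  assumes N: "extends_lebesgue N" and W: "graphon W"
  shows "kernel_operator N W"
proof -
  interpret prob_space N
    using N by (simp add: extends_lebesgue_def)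
  have space_N: "space N = {0..1}"
    using N by (simp add: extends_lebesgue_def)
  have "(\<lambda>x. x) \<in> N \<rightarrow>\<^sub>M lebesgue_on {0..1}"
    using N by (intro measurableI) (auto simp: extends_lebesgue_def Int_absorb2 dest: sets.sets_into_space)
  then have id: "(\<lambda>z. (fst z, snd z)) \<in> N \<Otimes>\<^sub>M N \<rightarrow>\<^sub>M lebesgue_on {0..1} \<Otimes>\<^sub>M lebesgue_on {0..1}"
    by (intro measurable_Pair measurable_compose[OF measurable_fst] measurable_compose[OF measurable_snd])
  have "case_prod W \<in> borel_measurable (lebesgue_on {0..1} \<Otimes>\<^sub>M lebesgue_on {0..1})"
    using W by (simp add: graphon_def)
  from measurable_compose[OF id this] have "case_prod W \<in> borel_measurable (N \<Otimes>\<^sub>M N)"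
    by simp
  then show ?thesis
    using W by unfold_locales (auto simp: graphon_def space_N)
qed

theorem theorem2p9:
  fixes N :: "real measure" and P :: "'w measure" and E :: "(real \<times> 'w) measure"
    and T \<alpha> l\<^sub>U l\<^sub>\<theta> :: real
    and \<theta> :: "'w profile" and U :: "'w utility" and A :: "real \<Rightarrow> 'w process set"
    and F :: "real \<Rightarrow> 'w measure"
  assumes "T > 0" and "prob_space P" and "extends_lebesgue N"
    and "rich_fubini_extension N P E"
    and F_def: "F = aug_filtration P \<theta>"
    and "\<theta> \<in> action_profiles N P T F"
    and "utility_functional P T F U"
    and A1: "assumption_A1 P T F U \<alpha> l\<^sub>U l\<^sub>\<theta>"
    and A2: "assumption_A2 N P T F U A"
    and measurability: "measurable_best_responses N P T F U A \<theta>"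
  shows "(\<forall>W. graphon W \<and> l\<^sub>U * lambda_1 N W < \<alpha> \<longrightarrow>
             unique_nash_equilibrium N P T F A U \<theta> W) \<and>
         (l\<^sub>U < \<alpha> \<longrightarrow>
             (\<forall>W. graphon W \<longrightarrow> unique_nash_equilibrium N P T F A U \<theta> W))"
proof -
  have \<alpha>: "0 < \<alpha>"
    using A1 by (simp add: assumption_A1_def)
  have "case_prod (\<theta> x) \<in> borel_measurable (time_measure T \<Otimes>\<^sub>M P)" if "x \<in> {0..1}" for x
    using assms(6) that by (simp add: action_profiles_def actions_def)
  then interpret process_space P T F
    using assms(1,2) unfolding F_def
    by (intro process_space.intro process_space_axioms.intro subalgebra_aug_filtration) auto
  have game: "unique_nash_equilibrium N P T F A U \<theta> W" if W: "graphon W" "l\<^sub>U * lambda_1 N W < \<alpha>" for W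
  proof -
    interpret kernel_operator N W
      by (rule kernel_operator_graphon[OF assms(3) W(1)])
    \<comment> \<open>\<open>max l\<^sub>U 0\<close> supplies the nonnegative constant that the
      locale asks for; for negative \<open>l\<^sub>U\<close> the contraction condition reads 0 <
      \<alpha>.\<close>
    interpret contractive_graphon_game P T F N W U A \<theta> \<alpha> "max l\<^sub>U 0" l\<^sub>\<theta>
    proof unfold_locales
      show "space N = {0..1}"
        using assms(3) by (simp add: extends_lebesgue_def)
      show "max l\<^sub>U 0 * lambda_1 N W < \<alpha>"
        using W(2) \<alpha> by (simp add: max_def)
      fix C z\<^sub>1 z\<^sub>2 h\<^sub>1 h\<^sub>2 a\<^sub>1 a\<^sub>2
      assume *: "C \<subseteq> actions P T F" "convex_actions C" "z\<^sub>1 \<in> actions P T F" "z\<^sub>2 \<in> actions P T F"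
        "h\<^sub>1 \<in> actions P T F" "h\<^sub>2 \<in> actions P T F"
        "is_arg_max (\<lambda>a. U a z\<^sub>1 h\<^sub>1) (\<lambda>a. a \<in> C) a\<^sub>1" "is_arg_max (\<lambda>a. U a z\<^sub>2 h\<^sub>2) (\<lambda>a. a \<in> C) a\<^sub>2"
      have "\<alpha> * act_dist P T a\<^sub>1 a\<^sub>2 \<le> l\<^sub>U * act_dist P T z\<^sub>1 z\<^sub>2 + l\<^sub>\<theta> * act_dist P T h\<^sub>1 h\<^sub>2"
        by (rule best_reply_stability[OF A1 *(1-6)]) (fact *)+
      also have "l\<^sub>U * act_dist P T z\<^sub>1 z\<^sub>2 \<le> max l\<^sub>U 0 * act_dist P T z\<^sub>1 z\<^sub>2"
        by (intro mult_right_mono act_dist_nonneg *) simp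
      finally show "\<alpha> * act_dist P T a\<^sub>1 a\<^sub>2 \<le> max l\<^sub>U 0 * act_dist P T z\<^sub>1 z\<^sub>2 + l\<^sub>\<theta> * act_dist P T h\<^sub>1 h\<^sub>2"
        by simp
    qed (use assms \<alpha> in auto)
    show ?thesis
      by (rule unique_nash_equilibrium)
  qed
  have "l\<^sub>U * lambda_1 N W < \<alpha>" if W: "graphon W" and "l\<^sub>U < \<alpha>" for W
  proof -
    interpret kernel_operator N W
      by (rule kernel_operator_graphon[OF assms(3) W])
    have "l\<^sub>U * lambda_1 N W \<le> max l\<^sub>U 0 * 1"
      using lambda_1_nonneg lambda_1_le_1 by (intro mult_mono) auto
    then show ?thesis
      using \<open>l\<^sub>U < \<alpha>\<close> \<alpha> by simp
  qed
  with game show ?thesis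
    by blast
qed

end
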